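(* Consider the problem $\min_{x\in\mathbb R^n} h(x)+P(\mathbb E[M]x)$ under the standing assumptions given in the context. Let $\{\theta_t\}$ be chosen according to the sampling regime given in the context, and let $\{(x_t,y_t,z_t)\}_{t>0}$ be the sequence generated by the Meta-ISAD algorithm (with an adaptive penalty oracle satisfying the APO requirements), assumed to be bounded. Then for every cluster point $(x^*,y^*,z^* )$ of $\{(x_t,y_t,z_t)\}_{t>0}$, the point $x^*$ is almost surely a critical point of $x\mapsto h(x)+P(\mathbb E[M]x)$, that is, $0\in\partial\big(h+P\circ\mathbb E[M]\big)(x^* )$.
   Context: **Problem.** $h:\mathbb R^n\to\mathbb R$ is twice continuously differentiable. $P:\mathbb R^n\to\mathbb R\cup\{\infty\}$ is proper, lower semicontinuous and prox-tractable: for all $u\in\mathbb R^n$, $\mu>0$, the set $\operatorname{argmin}_{v}\{P(v)+\frac1{2\mu}\|v-u\|^2\}$ is nonempty (and an element is efficiently computable). $M\in\mathbb R^{n\times n}$ is a random matrix with distribution $\pi$, entrywise expectation $\mathbb E[M]$ and finite entrywise variance; $\mathbb E[M]$ has full rank, so $\sigma:=\lambda_{\min}(\mathbb E[M]^T\mathbb E[M])>0$. The sampled matrices $M^1,M^2,\dots$ are i.i.d. with distribution $\pi$. Norms are $\ell_2$ (for matrices, the induced $\ell_2$ norm). **Subdifferential.** $\partial f$ denotes the general (limiting) subdifferential: $v\in\partial f(x)$ if there are $x^k\to x$ with $f(x^k)\to f(x)$ and $v^k\to v$ with $\liminf_{z\to x^k}\frac{f(z)-f(x^k)-\langle v^k,z-x^k\rangle}{\|z-x^k\|}\ge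 0$ for all $k$. **Sampling regime.** Fix an arbitrary $\epsilon_s>0$. If all entries of the sampled matrices are sub-Gaussian (a random variable $X$ is sub-Gaussian if $\mathbb E[\exp(X^2/K)]\le 2$ for some $K>0$), then $\theta_t=\lceil t^{1+\epsilon_s}\rceil$; otherwise $\theta_t=\lceil t^{2+\epsilon_s}\rceil$. **Meta-ISAD algorithm.** Input: $x_0,z_0\in\mathbb R^n$ ($y_0$ arbitrary), $\beta_0>0$, $\{\theta_t\}$, and a convex $\phi\in C^2(\mathbb R^n)$, with $D_\phi(x,x')=\phi(x)-\phi(x')-\langle\nabla\phi(x'),x-x'\rangle$. For $t=0,1,2,\dots$: sample $M^{\theta_t+1},\dots,M^{\theta_{t+1}}$ and set $\bar M^{t+1}=\frac{1}{\theta_{t+1}}\sum_{i=1}^{\theta_{t+1}}M^i$; then - $y_{t+1}\in\operatorname{argmin}_y\{P(y)+\langle z_t,y\rangle+\frac{\beta_t}{2}\|\bar M^{t+1}x_t-y\|^2\}$; - $x_{t+1}$ is a critical point (zero gradient) of $g^{t+1}(x):=h(x)-\langle z_t,\bar M^{t+1}x\rangle+\frac{\beta_t}{2}\|\bar M^{t+1}x-y_{t+1}\|^2+D_\phi(x,x_t)$; - $z_{t+1}=z_t-\beta_t(\bar M^{t+1}x_{t+1}-y_{t+1})$; - $\beta_{t+1}$ is the output of an adaptive penalty oracle (APO). **Empirical Lipschitz constant.** For $F:\mathbb R^k\to\mathbb R^l$ and a sequence $\{x_t\}_{t\ge0}$, $L^e_F(\{x_t\}_{t\ge0})=\sup_{t\ge0,\,x_{t+1}\ne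 x_t}\frac{\|F(x_{t+1})-F(x_t)\|}{\|x_{t+1}-x_t\|}$, and it equals $0$ if $x_{t+1}=x_t$ for all $t$. **APO requirements.** The oracle returns positive scalars $\beta_t>0$, and for the generated sequence there is an index $K_{stable}>0$ such that: (1) $\beta_k=\beta_{K_{stable}}$ for all $k>K_{stable}$; (2) there is $\rho>0$ such that for all $k>K_{stable}$, $g^{k+1}(x_{k+1})-g^{k+1}(x_k)\le-\frac{\rho}{2}\|x_{k+1}-x_k\|^2$ and $\rho>\frac{8}{\beta_k\sigma}\Big(\big(L^e_{\nabla h+\nabla\phi}(\{x_t\}_{t\ge0})\big)^2+\big(L^e_{\nabla\phi}(\{x_t\}_{t\ge0})\big)^2\Big)$. *)

theory Defs
  imports "HOL-Probability.Probability"
begin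

section \<open>Smooth functions\<close>

definition grad :: "('a::real_inner \<Rightarrow> real) \<Rightarrow> 'a \<Rightarrow> 'a" where
  "grad f x = (THE D. GDERIV f x :> D)"

lemma grad_eqI:
  assumes "GDERIV f x :> D"
  shows "grad f x = D"
  unfolding grad_def
proof (rule the_equality)
  fix D' assume "GDERIV f x :> D'"
  then have "(\<lambda>h. inner h D') = (\<lambda>h. inner h D)"
    using assms has_derivative_unique[of f "\<lambda>h. inner h D'" x "\<lambda>h. inner h D"]
    by (simp add: gderiv_def)
  then have "inner (D' - D) D' = inner (D' - D) D"
    by (rule fun_cong)
  then have "inner (D' - D) (D' - D) = 0"
    by (simp add: inner_diff_right)
  then show "D' = D"
    by simp
qed (rule assms)

definition twice_continuously_differentiable :: "(real^'n \<Rightarrow> real) \<Rightarrow> bool" where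
  "twice_continuously_differentiable f \<longleftrightarrow>
    (\<exists>(G :: real^'n \<Rightarrow> real^'n) (H :: real^'n \<Rightarrow> real^'n^'n).
       (\<forall>x. GDERIV f x :> G x) \<and>
       (\<forall>x. (G has_derivative (\<lambda>v. H x *v v)) (at x)) \<and>
       continuous_on UNIV H)"

definition bregman :: "('a::real_inner \<Rightarrow> real) \<Rightarrow> 'a \<Rightarrow> 'a \<Rightarrow> real" where
  "bregman \<phi> x x' = \<phi> x - \<phi> x' - grad \<phi> x' \<bullet> (x - x')"


section \<open>Extended-valued functions\<close>

definition proper :: "('a \<Rightarrow> ereal) \<Rightarrow> bool" where
  "proper f \<longleftrightarrow> (\<forall>x. f x \<noteq> -\<infinity>) \<and> (\<exists>x. f x \<noteq> \<infinity>)"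

definition lower_semicontinuous :: "('a::topological_space \<Rightarrow> ereal) \<Rightarrow> bool" where
  "lower_semicontinuous f \<longleftrightarrow> (\<forall>x. f x \<le> Liminf (at x) f)"

definition argmin :: "('a \<Rightarrow> ereal) \<Rightarrow> 'a set" where
  "argmin f = {x. is_arg_min f (\<lambda>_. True) x}"

definition prox_tractable :: "('a::real_normed_vector \<Rightarrow> ereal) \<Rightarrow> bool" where
  "prox_tractable P \<longleftrightarrow>
    (\<forall>u. \<forall>\<mu>>0. argmin (\<lambda>v. P v + ereal (1 / (2 * \<mu>) * (norm (v - u))\<^sup>2)) \<noteq> {})"

text \<open>Subgradients only exist at points where \<open>f\<close> is finite; this is why finiteness is
  required at the base point and along the approximating sequence, where the difference
  quotients would otherwise involve \<open>\<infinity> - \<infinity>\<close>.\<close>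

definition limiting_subdifferential :: "('a::real_inner \<Rightarrow> ereal) \<Rightarrow> 'a \<Rightarrow> 'a set" where
  "limiting_subdifferential f x =
    {v. \<bar>f x\<bar> \<noteq> \<infinity> \<and>
      (\<exists>xs vs. xs \<longlonglongrightarrow> x \<and> (\<lambda>k. f (xs k)) \<longlonglongrightarrow> f x \<and> vs \<longlonglongrightarrow> v \<and>
        (\<forall>k::nat. \<bar>f (xs k)\<bar> \<noteq> \<infinity> \<and>
          Liminf (at (xs k))
            (\<lambda>z. (f z - f (xs k) - ereal (vs k \<bullet> (z - xs k))) / ereal (norm (z - xs k))) \<ge> 0))}"


section \<open>Random matrices\<close>

text \<open>The nonnegative integral is used so that a divergent expectation counts as infinite.\<close>

definition sub_gaussian :: "'w measure \<Rightarrow> ('w \<Rightarrow> real) \<Rightarrow> bool" where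
  "sub_gaussian \<Omega> X \<longleftrightarrow> X \<in> borel_measurable \<Omega> \<and>
    (\<exists>K>0. (\<integral>\<^sup>+ \<omega>. ennreal (exp ((X \<omega>)\<^sup>2 / K)) \<partial>\<Omega>) \<le> 2)"

definition mean_matrix :: "(real^'n^'m) measure \<Rightarrow> real^'n^'m" where
  "mean_matrix \<pi> = (\<chi> i j. \<integral>A. A $ i $ j \<partial>\<pi>)"

definition finite_entrywise_variance :: "(real^'n^'m) measure \<Rightarrow> bool" where
  "finite_entrywise_variance \<pi> \<longleftrightarrow>
    (\<forall>i j. integrable \<pi> (\<lambda>A. A $ i $ j) \<and> integrable \<pi> (\<lambda>A. (A $ i $ j)\<^sup>2))"

definition lambda_min :: "real^'n^'n \<Rightarrow> real" where
  "lambda_min A = (LEAST c. \<exists>v. v \<noteq> 0 \<and> A *v v = c *\<^sub>R v)"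

definition sample_size :: "(real^'n^'m) measure \<Rightarrow> real \<Rightarrow> nat \<Rightarrow> nat" where
  "sample_size \<pi> \<epsilon> t =
    (if \<forall>i j. sub_gaussian \<pi> (\<lambda>A. A $ i $ j)
     then nat \<lceil>real t powr (1 + \<epsilon>)\<rceil>
     else nat \<lceil>real t powr (2 + \<epsilon>)\<rceil>)"

definition sample_mean :: "(nat \<Rightarrow> real^'n^'m) \<Rightarrow> (nat \<Rightarrow> nat) \<Rightarrow> nat \<Rightarrow> real^'n^'m" where
  "sample_mean M \<theta> t = (1 / real (\<theta> t)) *\<^sub>R (\<Sum>i=1..\<theta> t. M i)"


section \<open>The algorithm along one sample path\<close>

definition x_objective ::
  "(real^'n \<Rightarrow> real) \<Rightarrow> (real^'n \<Rightarrow> real) \<Rightarrow> (nat \<Rightarrow> real^'n^'n) \<Rightarrow>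
   (nat \<Rightarrow> real^'n) \<Rightarrow> (nat \<Rightarrow> real^'n) \<Rightarrow> (nat \<Rightarrow> real^'n) \<Rightarrow> (nat \<Rightarrow> real) \<Rightarrow>
   nat \<Rightarrow> real^'n \<Rightarrow> real" where
  "x_objective h \<phi> A x y z \<beta> t u =
    h u - z t \<bullet> (A (Suc t) *v u) + \<beta> t / 2 * (norm (A (Suc t) *v u - y (Suc t)))\<^sup>2
    + bregman \<phi> u (x t)"

text \<open>The matrices \<open>A t\<close> are the sample means; \<open>\<beta>\<close> is only constrained by its initial value
  here, since its updates come from the adaptive penalty oracle.\<close>

definition meta_isad ::
  "(real^'n \<Rightarrow> real) \<Rightarrow> (real^'n \<Rightarrow> ereal) \<Rightarrow> (real^'n \<Rightarrow> real) \<Rightarrow> (nat \<Rightarrow> real^'n^'n) \<Rightarrow>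
   real^'n \<Rightarrow> real^'n \<Rightarrow> real \<Rightarrow>
   (nat \<Rightarrow> real^'n) \<Rightarrow> (nat \<Rightarrow> real^'n) \<Rightarrow> (nat \<Rightarrow> real^'n) \<Rightarrow> (nat \<Rightarrow> real) \<Rightarrow> bool" where
  "meta_isad h P \<phi> A x0 z0 \<beta>0 x y z \<beta> \<longleftrightarrow>
    x 0 = x0 \<and> z 0 = z0 \<and> \<beta> 0 = \<beta>0 \<and>
    (\<forall>t. y (Suc t) \<in> argmin (\<lambda>u. P u + ereal (z t \<bullet> u)
                              + ereal (\<beta> t / 2 * (norm (A (Suc t) *v x t - u))\<^sup>2)) \<and>
         GDERIV (x_objective h \<phi> A x y z \<beta> t) (x (Suc t)) :> 0 \<and>
         z (Suc t) = z t - \<beta> t *\<^sub>R (A (Suc t) *v x (Suc t) - y (Suc t)))"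

definition empirical_lipschitz ::
  "('a::real_normed_vector \<Rightarrow> 'b::real_normed_vector) \<Rightarrow> (nat \<Rightarrow> 'a) \<Rightarrow> ereal" where
  "empirical_lipschitz F x =
    (if \<forall>t. x (Suc t) = x t then 0
     else SUP t\<in>{t. x (Suc t) \<noteq> x t}.
            ereal (norm (F (x (Suc t)) - F (x t)) / norm (x (Suc t) - x t)))"

definition apo_requirements ::
  "real \<Rightarrow> (real^'n \<Rightarrow> real) \<Rightarrow> (real^'n \<Rightarrow> real) \<Rightarrow> (nat \<Rightarrow> real^'n^'n) \<Rightarrow>
   (nat \<Rightarrow> real^'n) \<Rightarrow> (nat \<Rightarrow> real^'n) \<Rightarrow> (nat \<Rightarrow> real^'n) \<Rightarrow> (nat \<Rightarrow> real) \<Rightarrow> bool" where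
  "apo_requirements \<sigma> h \<phi> A x y z \<beta> \<longleftrightarrow>
    (\<forall>t. \<beta> t > 0) \<and>
    (\<exists>K>0.
      (\<forall>k>K. \<beta> k = \<beta> K) \<and>
      (\<exists>\<rho>>0. \<forall>k>K.
        x_objective h \<phi> A x y z \<beta> k (x (Suc k)) - x_objective h \<phi> A x y z \<beta> k (x k)
          \<le> - (\<rho> / 2) * (norm (x (Suc k) - x k))\<^sup>2 \<and>
        ereal \<rho> > ereal (8 / (\<beta> k * \<sigma>)) *
          ((empirical_lipschitz (\<lambda>u. grad h u + grad \<phi> u) x)\<^sup>2
           + (empirical_lipschitz (grad \<phi>) x)\<^sup>2)))"

definition cluster_point :: "(nat \<Rightarrow> 'a::topological_space) \<Rightarrow> 'a \<Rightarrow> bool" where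
  "cluster_point s p \<longleftrightarrow> (\<exists>r. strict_mono r \<and> (s \<circ> r) \<longlonglongrightarrow> p)"

end

theory Submission
  imports Defs "HOL-Real_Asymp.Real_Asymp"
begin

text \<open>
  The probabilistic part supplies exactly two facts about almost every sample path: the sample
  means \<open>A\<^sub>t\<close> converge to \<open>E = E[M]\<close>, and \<open>\<Sum> \<parallel>A\<^sub>t\<^sub>+\<^sub>1 - A\<^sub>t\<parallel> < \<infinity>\<close>. The second is the decisive one. It need not
  hold that \<open>\<Sum> \<parallel>A\<^sub>t - E\<parallel> < \<infinity>\<close>, but two running means over \<open>m \<le> n\<close> samples share their first
  \<open>m\<close> terms and differ in mean square only by \<open>V (1 / m - 1 / n)\<close>. With \<open>\<theta>\<^sub>t = \<lceil>t powr p\<rceil>\<close> the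
  increments are therefore of order \<open>t powr (- (p + 1) / 2)\<close> in \<open>L\<^sup>1\<close>, which is summable for every \<open>p > 1\<close>
  (\<open>sample_mean_convergence\<close>).

  On such a path the augmented Lagrangian
  \<open>h x + P y - \<langle>z, A\<^sub>t x - y\<rangle> + b / 2 \<parallel>A\<^sub>t x - y\<parallel>\<^sup>2\<close> is almost a Lyapunov function once the penalty
  has settled at \<open>b\<close>. The \<open>y\<close>-step does not increase it, the \<open>x\<close>-step decreases it by
  \<open>\<rho> / 2 \<parallel>x\<^sub>t\<^sub>+\<^sub>1 - x\<^sub>t\<parallel>\<^sup>2\<close>, the change of matrix costs a multiple of \<open>\<parallel>A\<^sub>t\<^sub>+\<^sub>1 - A\<^sub>t\<parallel>\<close>, and the multiplier
  step adds \<open>\<parallel>z\<^sub>t\<^sub>+\<^sub>1 - z\<^sub>t\<parallel>\<^sup>2 / b\<close>. The last term is controlled by stationarity of the \<open>x\<close>-step, which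
  reads \<open>A\<^sub>t\<^sub>+\<^sub>1\<^sup>T z\<^sub>t\<^sub>+\<^sub>1 = \<nabla>h(x\<^sub>t\<^sub>+\<^sub>1) + \<nabla>\<phi>(x\<^sub>t\<^sub>+\<^sub>1) - \<nabla>\<phi>(x\<^sub>t)\<close>: since \<open>A\<^sub>t\<^sup>T\<close> is eventually bounded below by nearly
  \<open>sqrt \<sigma>\<close> (\<open>lambda_min_gram\<close>), a dual step is bounded by the last two primal steps and the change of the
  matrix, and the oracle's lower bound on \<open>\<rho>\<close> says that this is outweighed by the primal decrease
  (\<open>lyapunov_descent\<close>). The Lagrangian is bounded below on the bounded iterates, so primal and dual steps
  tend to \<open>0\<close> (\<open>steps_vanish\<close>).

  In the limit the updates become \<open>E x\<^sup>* = y\<^sup>*\<close>, \<open>\<nabla>h(x\<^sup>*) = E\<^sup>T z\<^sup>*\<close> and \<open>- z\<^sup>* \<in> \<partial>P(y\<^sup>*)\<close>, and invertibility of \<open>E\<close>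
  turns them into \<open>0 \<in> \<partial>(h + P \<circ> E)(x\<^sup>*)\<close> (\<open>cluster_point_critical\<close>).
\<close>

section \<open>Running means of uncorrelated random variables\<close>

text \<open>By monotone convergence the sum has a finite integral, hence is finite almost everywhere.\<close>

lemma AE_summable_of_summable_integrals:
  fixes f :: "nat \<Rightarrow> 'a \<Rightarrow> real"
  assumes int: "\<And>n. integrable M (f n)"
    and nonneg: "\<And>n \<omega>. 0 \<le> f n \<omega>"
    and sum: "summable (\<lambda>n. \<integral>\<omega>. f n \<omega> \<partial>M)"
  shows "AE \<omega> in M. summable (\<lambda>n. f n \<omega>)"
proof -
  have [measurable]: "f n \<in> borel_measurable M" for n
    using int by auto
  have "(\<integral>\<^sup>+\<omega>. (\<Sum>n. ennreal (f n \<omega>)) \<partial>M) = (\<Sum>n. \<integral>\<^sup>+\<omega>. ennreal (f n \<omega>) \<partial>M)"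
    by (rule nn_integral_suminf) measurable
  also have "\<dots> = (\<Sum>n. ennreal (\<integral>\<omega>. f n \<omega> \<partial>M))"
    by (simp add: nn_integral_eq_integral int nonneg)
  also have "\<dots> = ennreal (\<Sum>n. \<integral>\<omega>. f n \<omega> \<partial>M)"
    by (intro suminf_ennreal2 sum) (simp add: nonneg)
  finally have "(\<integral>\<^sup>+\<omega>. (\<Sum>n. ennreal (f n \<omega>)) \<partial>M) \<noteq> \<infinity>"
    by simp
  then have "AE \<omega> in M. (\<Sum>n. ennreal (f n \<omega>)) \<noteq> \<infinity>"
    by (intro nn_integral_PInf_AE) auto
  then show ?thesis
    by eventually_elim (auto intro: summable_suminf_not_top nonneg)
qed

lemma (in prob_space) expectation_abs_le_sqrt:
  fixes f :: "'a \<Rightarrow> real"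
  assumes "f \<in> borel_measurable M" "integrable M (\<lambda>\<omega>. (f \<omega>)\<^sup>2)"
  shows "integrable M (\<lambda>\<omega>. \<bar>f \<omega>\<bar>)" "expectation (\<lambda>\<omega>. \<bar>f \<omega>\<bar>) \<le> sqrt (expectation (\<lambda>\<omega>. (f \<omega>)\<^sup>2))"
proof -
  show int: "integrable M (\<lambda>\<omega>. \<bar>f \<omega>\<bar>)"
    using square_integrable_imp_integrable[OF assms] by simp
  have "0 \<le> variance (\<lambda>\<omega>. \<bar>f \<omega>\<bar>)"
    by (rule variance_positive)
  also have "\<dots> = expectation (\<lambda>\<omega>. (f \<omega>)\<^sup>2) - (expectation (\<lambda>\<omega>. \<bar>f \<omega>\<bar>))\<^sup>2"
    using int assms by (subst variance_eq) auto
  finally show "expectation (\<lambda>\<omega>. \<bar>f \<omega>\<bar>) \<le> sqrt (expectation (\<lambda>\<omega>. (f \<omega>)\<^sup>2))"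
    by (intro real_le_rsqrt) simp
qed

lemma integral_square_orthogonal_sum:
  fixes X :: "'i \<Rightarrow> 'a \<Rightarrow> real"
  assumes I: "finite I"
    and int: "\<And>i j. i \<in> I \<Longrightarrow> j \<in> I \<Longrightarrow> integrable M (\<lambda>\<omega>. X i \<omega> * X j \<omega>)"
    and orth: "\<And>i j. i \<in> I \<Longrightarrow> j \<in> I \<Longrightarrow> i \<noteq> j \<Longrightarrow> (\<integral>\<omega>. X i \<omega> * X j \<omega> \<partial>M) = 0"
    and var: "\<And>i. i \<in> I \<Longrightarrow> (\<integral>\<omega>. X i \<omega> * X i \<omega> \<partial>M) = V"
  shows "integrable M (\<lambda>\<omega>. (\<Sum>i\<in>I. c i * X i \<omega>)\<^sup>2)"
    and "(\<integral>\<omega>. (\<Sum>i\<in>I. c i * X i \<omega>)\<^sup>2 \<partial>M) = V * (\<Sum>i\<in>I. (c i)\<^sup>2)"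
proof -
  have eq: "(\<Sum>i\<in>I. c i * X i \<omega>)\<^sup>2 = (\<Sum>i\<in>I. \<Sum>j\<in>I. c i * c j * (X i \<omega> * X j \<omega>))" for \<omega>
    by (simp add: power2_eq_square sum_product mult_ac)
  show "integrable M (\<lambda>\<omega>. (\<Sum>i\<in>I. c i * X i \<omega>)\<^sup>2)"
    unfolding eq by (intro Bochner_Integration.integrable_sum integrable_mult_right int)
  have "(\<integral>\<omega>. (\<Sum>i\<in>I. c i * X i \<omega>)\<^sup>2 \<partial>M)
      = (\<Sum>i\<in>I. \<Sum>j\<in>I. c i * c j * (\<integral>\<omega>. X i \<omega> * X j \<omega> \<partial>M))"
    unfolding eq
    by (simp add: Bochner_Integration.integral_sum Bochner_Integration.integrable_sum int)
  also have "\<dots> = (\<Sum>i\<in>I. \<Sum>j\<in>I. if i = j then V * (c i)\<^sup>2 else 0)"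
    by (intro sum.cong refl) (auto simp: orth var power2_eq_square)
  also have "\<dots> = V * (\<Sum>i\<in>I. (c i)\<^sup>2)"
    using I by (simp add: sum_distrib_left)
  finally show "(\<integral>\<omega>. (\<Sum>i\<in>I. c i * X i \<omega>)\<^sup>2 \<partial>M) = V * (\<Sum>i\<in>I. (c i)\<^sup>2)" .
qed

text \<open>Sequences start at index \<open>1\<close>, and the mean of the empty sample is \<open>0\<close>.\<close>

definition running_mean :: "(nat \<Rightarrow> real) \<Rightarrow> nat \<Rightarrow> real" where
  "running_mean s n = (\<Sum>i=1..n. s i) / real n"

text \<open>Because \<open>S\<^sub>m\<close> and \<open>S\<^sub>n\<close> share their first \<open>m\<close> summands, their covariance is \<open>V / n\<close>, and the
  second moment of the difference is \<open>V / m - V / n\<close>. For \<open>n\<close> close to \<open>m\<close> the two means are therefore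
  much closer to each other than either is to the expectation.\<close>

lemma second_moment_running_mean_diff:
  fixes X :: "nat \<Rightarrow> 'a \<Rightarrow> real"
  assumes int: "\<And>i j. 1 \<le> i \<Longrightarrow> 1 \<le> j \<Longrightarrow> integrable M (\<lambda>\<omega>. X i \<omega> * X j \<omega>)"
    and orth: "\<And>i j. 1 \<le> i \<Longrightarrow> 1 \<le> j \<Longrightarrow> i \<noteq> j \<Longrightarrow> (\<integral>\<omega>. X i \<omega> * X j \<omega> \<partial>M) = 0"
    and var: "\<And>i. 1 \<le> i \<Longrightarrow> (\<integral>\<omega>. X i \<omega> * X i \<omega> \<partial>M) = V"
    and m: "1 \<le> m" "m \<le> n"
  shows "integrable M (\<lambda>\<omega>. (running_mean (\<lambda>i. X i \<omega>) n - running_mean (\<lambda>i. X i \<omega>) m)\<^sup>2)"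
    and "(\<integral>\<omega>. (running_mean (\<lambda>i. X i \<omega>) n - running_mean (\<lambda>i. X i \<omega>) m)\<^sup>2 \<partial>M)
           = V * (1 / real m - 1 / real n)"
proof -
  define c where "c i = 1 / real n - (if i \<le> m then 1 / real m else 0)" for i
  have split: "{1..n} = {1..m} \<union> {m<..n}" "{1..m} \<inter> {m<..n} = {}"
    using m by auto
  have eq: "running_mean (\<lambda>i. X i \<omega>) n - running_mean (\<lambda>i. X i \<omega>) m = (\<Sum>i=1..n. c i * X i \<omega>)"
    for \<omega>
    unfolding running_mean_def split(1) c_def
    by (subst (1 2) sum.union_disjoint)
       (auto simp: algebra_simps sum.distrib sum_subtractf add_divide_distrib
          simp flip: sum_divide_distrib sum_distrib_left)
  have "(\<Sum>i=1..n. (c i)\<^sup>2)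
      = real m * (1 / real n - 1 / real m)\<^sup>2 + (real n - real m) * (1 / real n)\<^sup>2"
    unfolding split(1) using m
    by (subst sum.union_disjoint) (auto simp: c_def of_nat_diff)
  also have "\<dots> = 1 / real m - 1 / real n"
    using m by (simp add: field_simps power2_eq_square)
  finally have c: "(\<Sum>i=1..n. (c i)\<^sup>2) = 1 / real m - 1 / real n" .
  show "integrable M (\<lambda>\<omega>. (running_mean (\<lambda>i. X i \<omega>) n - running_mean (\<lambda>i. X i \<omega>) m)\<^sup>2)"
    unfolding eq by (rule integral_square_orthogonal_sum(1)[where V = V]) (auto intro: int orth var)
  show "(\<integral>\<omega>. (running_mean (\<lambda>i. X i \<omega>) n - running_mean (\<lambda>i. X i \<omega>) m)\<^sup>2 \<partial>M)
           = V * (1 / real m - 1 / real n)"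
    unfolding eq c[symmetric]
    by (rule integral_square_orthogonal_sum(2)) (auto intro: int orth var)
qed

lemma second_moment_running_mean:
  fixes X :: "nat \<Rightarrow> 'a \<Rightarrow> real"
  assumes int: "\<And>i j. 1 \<le> i \<Longrightarrow> 1 \<le> j \<Longrightarrow> integrable M (\<lambda>\<omega>. X i \<omega> * X j \<omega>)"
    and orth: "\<And>i j. 1 \<le> i \<Longrightarrow> 1 \<le> j \<Longrightarrow> i \<noteq> j \<Longrightarrow> (\<integral>\<omega>. X i \<omega> * X j \<omega> \<partial>M) = 0"
    and var: "\<And>i. 1 \<le> i \<Longrightarrow> (\<integral>\<omega>. X i \<omega> * X i \<omega> \<partial>M) = V"
  shows "integrable M (\<lambda>\<omega>. (running_mean (\<lambda>i. X i \<omega>) n)\<^sup>2)"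
    and "(\<integral>\<omega>. (running_mean (\<lambda>i. X i \<omega>) n)\<^sup>2 \<partial>M) = V / real n"
proof -
  have eq: "running_mean (\<lambda>i. X i \<omega>) n = (\<Sum>i=1..n. (1 / real n) * X i \<omega>)" for \<omega>
    by (simp add: running_mean_def sum_divide_distrib)
  show "integrable M (\<lambda>\<omega>. (running_mean (\<lambda>i. X i \<omega>) n)\<^sup>2)"
    unfolding eq by (rule integral_square_orthogonal_sum(1)[where V = V]) (auto intro: int orth var)
  have "(\<integral>\<omega>. (running_mean (\<lambda>i. X i \<omega>) n)\<^sup>2 \<partial>M) = V * (\<Sum>i=1..n. (1 / real n)\<^sup>2)"
    unfolding eq by (rule integral_square_orthogonal_sum(2)) (auto intro: int orth var)
  also have "\<dots> = V / real n"
    by (simp add: power2_eq_square)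
  finally show "(\<integral>\<omega>. (running_mean (\<lambda>i. X i \<omega>) n)\<^sup>2 \<partial>M) = V / real n" .
qed

text \<open>Both branches of \<^const>\<open>sample_size\<close> have this form, with an exponent \<open>p > 1\<close>.\<close>

definition power_schedule :: "real \<Rightarrow> nat \<Rightarrow> nat" where
  "power_schedule p t = nat \<lceil>real t powr p\<rceil>"

lemma power_schedule_bounds:
  shows "real t powr p \<le> real (power_schedule p t)"
    and "real (power_schedule p t) \<le> real t powr p + 1"
  unfolding power_schedule_def by (simp_all add: of_nat_nat) 

lemma power_schedule_mono: "0 \<le> p \<Longrightarrow> s \<le> t \<Longrightarrow> power_schedule p s \<le> power_schedule p t"
  unfolding power_schedule_def by (intro nat_mono ceiling_mono powr_mono2) auto

lemma power_schedule_pos: "1 \<le> t \<Longrightarrow> 1 \<le> power_schedule p t"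
  unfolding power_schedule_def by (simp add: le_nat_iff Suc_le_eq)

lemma summable_inverse_power_schedule:
  assumes "1 < p"
  shows "summable (\<lambda>t. 1 / real (power_schedule p t))"
proof (rule summable_comparison_test')
  show "summable (\<lambda>t. real t powr - p)"
    using assms by (simp add: summable_real_powr_iff)
  show "norm (1 / real (power_schedule p t)) \<le> real t powr - p" if "1 \<le> t" for t
    using that power_schedule_bounds(1)[of t p]
    by (auto simp: powr_minus divide_simps power_schedule_pos)
qed

text \<open>By the mean value theorem \<open>\<theta>\<^sub>t\<^sub>+\<^sub>1 - \<theta>\<^sub>t\<close> is of order \<open>t powr (p - 1)\<close>, so the difference of the
  reciprocals is of order \<open>t powr (- p - 1)\<close>; its square root has the exponent
  \<open>- (p + 1) / 2 < - 1\<close>.\<close>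

lemma summable_sqrt_power_schedule_increment:
  assumes "1 < p"
  shows "summable (\<lambda>t. sqrt (1 / real (power_schedule p t) - 1 / real (power_schedule p (Suc t))))"
proof -
  define b where "b t = sqrt (((real t + 1) powr p + 1 - real t powr p) / (real t powr p)\<^sup>2)" for t :: nat
  have "b \<in> O(\<lambda>t. real t powr (- (p + 1) / 2))"
    unfolding b_def using assms by real_asymp
  moreover have "summable (\<lambda>t. norm (real t powr (- (p + 1) / 2)))"
    using assms by (simp add: summable_real_powr_iff)
  ultimately have b: "summable b"
    by (rule summable_comparison_test_bigo[rotated])
  show ?thesis
  proof (rule summable_comparison_test'[OF b])
    fix t :: nat assume t: "1 \<le> t"
    let ?m = "real (power_schedule p t)" and ?n = "real (power_schedule p (Suc t))"
    have m: "1 \<le> ?m" "?m \<le> ?n"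
      using power_schedule_pos[OF t, of p] power_schedule_mono[of p t "Suc t"] assms by auto
    have tp: "0 < real t powr p" using t by simp
    have "1 / ?m - 1 / ?n = (?n - ?m) / (?m * ?n)"
      using m by (simp add: field_simps)
    also have "\<dots> \<le> ((real t + 1) powr p + 1 - real t powr p) / (real t powr p * real t powr p)"
      using power_schedule_bounds(1)[of t p] power_schedule_bounds(2)[of p "Suc t"] m tp
      by (intro frac_le mult_mono mult_pos_pos) (auto simp: add.commute)
    finally have "1 / ?m - 1 / ?n \<le> ((real t + 1) powr p + 1 - real t powr p) / (real t powr p)\<^sup>2"
      by (simp add: power2_eq_square)
    moreover have "0 \<le> 1 / ?m - 1 / ?n"
      using m by (simp add: field_simps)
    ultimately show "norm (sqrt (1 / ?m - 1 / ?n)) \<le> b t"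
      unfolding b_def by simp
  qed
qed

text \<open>Two rates are combined: \<open>\<Sum> E S\<^sub>t\<^sup>2 = V \<Sum> 1 / \<theta>\<^sub>t\<close> gives convergence to the mean,
  and \<open>\<Sum> E \<bar>S\<^sub>t\<^sub>+\<^sub>1 - S\<^sub>t\<bar> \<le> \<Sum> sqrt (V (1 / \<theta>\<^sub>t - 1 / \<theta>\<^sub>t\<^sub>+\<^sub>1))\<close> gives absolute summability of the
  increments.\<close>

lemma (in prob_space) running_mean_along_power_schedule:
  fixes X :: "nat \<Rightarrow> 'a \<Rightarrow> real"
  assumes meas: "\<And>i. 1 \<le> i \<Longrightarrow> X i \<in> borel_measurable M"
    and int: "\<And>i j. 1 \<le> i \<Longrightarrow> 1 \<le> j \<Longrightarrow> integrable M (\<lambda>\<omega>. X i \<omega> * X j \<omega>)"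
    and orth: "\<And>i j. 1 \<le> i \<Longrightarrow> 1 \<le> j \<Longrightarrow> i \<noteq> j \<Longrightarrow> (\<integral>\<omega>. X i \<omega> * X j \<omega> \<partial>M) = 0"
    and var: "\<And>i. 1 \<le> i \<Longrightarrow> (\<integral>\<omega>. X i \<omega> * X i \<omega> \<partial>M) = V"
    and p: "1 < p"
  defines "S \<equiv> \<lambda>t \<omega>. running_mean (\<lambda>i. X i \<omega>) (power_schedule p t)"
  shows "AE \<omega> in M. (\<lambda>t. S t \<omega>) \<longlonglongrightarrow> 0"
    and "AE \<omega> in M. summable (\<lambda>t. \<bar>S (Suc t) \<omega> - S t \<omega>\<bar>)"
proof -
  note moments = second_moment_running_mean[where X = X, OF int orth var]
    second_moment_running_mean_diff[where X = X, OF int orth var]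
  have "AE \<omega> in M. summable (\<lambda>t. (S t \<omega>)\<^sup>2)"
  proof (rule AE_summable_of_summable_integrals)
    show "integrable M (\<lambda>\<omega>. (S t \<omega>)\<^sup>2)" for t
      unfolding S_def by (rule moments)
    have "(\<integral>\<omega>. (S t \<omega>)\<^sup>2 \<partial>M) = V / power_schedule p t" for t
      unfolding S_def by (rule moments)
    then show "summable (\<lambda>t. \<integral>\<omega>. (S t \<omega>)\<^sup>2 \<partial>M)"
      using summable_mult[OF summable_inverse_power_schedule[OF p], of V] by simp
  qed simp
  then show "AE \<omega> in M. (\<lambda>t. S t \<omega>) \<longlonglongrightarrow> 0"
  proof eventually_elim
    case (elim \<omega>)
    from tendsto_real_sqrt[OF summable_LIMSEQ_zero[OF elim]] show ?case
      by (simp add: tendsto_rabs_zero_iff)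
  qed
  have meas_S: "S t \<in> borel_measurable M" for t
    unfolding S_def running_mean_def by (intro borel_measurable_divide borel_measurable_sum meas) auto
  \<comment> \<open>The increment from time \<open>0\<close> is left out: the sample at that time is empty.\<close>
  have "AE \<omega> in M. summable (\<lambda>t. \<bar>S (Suc (Suc t)) \<omega> - S (Suc t) \<omega>\<bar>)"
  proof (rule AE_summable_of_summable_integrals)
    let ?D = "\<lambda>t \<omega>. S (Suc (Suc t)) \<omega> - S (Suc t) \<omega>"
    have sq: "integrable M (\<lambda>\<omega>. (?D t \<omega>)\<^sup>2)"
      "expectation (\<lambda>\<omega>. (?D t \<omega>)\<^sup>2)
        = V * (1 / power_schedule p (Suc t) - 1 / power_schedule p (Suc (Suc t)))" for t
      unfolding S_def using p
      by (auto intro!: moments power_schedule_pos[of "Suc t" p, simplified] power_schedule_mono)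
    note abs = expectation_abs_le_sqrt[OF borel_measurable_diff[OF meas_S meas_S] sq(1)]
    show "integrable M (\<lambda>\<omega>. \<bar>?D t \<omega>\<bar>)" for t
      by (rule abs)
    show "summable (\<lambda>t. expectation (\<lambda>\<omega>. \<bar>?D t \<omega>\<bar>))"
    proof (rule summable_comparison_test')
      let ?r = "\<lambda>t. sqrt (1 / real (power_schedule p t) - 1 / real (power_schedule p (Suc t)))"
      show "summable (\<lambda>t. sqrt V * ?r (Suc t))"
        by (intro summable_mult) (subst summable_Suc_iff, rule summable_sqrt_power_schedule_increment[OF p])
      show "norm (expectation (\<lambda>\<omega>. \<bar>?D t \<omega>\<bar>)) \<le> sqrt V * ?r (Suc t)" for t
        using abs(2)[of t] unfolding sq(2) by (simp add: real_sqrt_mult)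
    qed
  qed simp
  then show "AE \<omega> in M. summable (\<lambda>t. \<bar>S (Suc t) \<omega> - S t \<omega>\<bar>)"
    by eventually_elim (subst (asm) summable_Suc_iff)
qed

section \<open>Matrices and the least eigenvalue of a Gram matrix\<close>

lemma norm_matrix_vector_mult_le:
  fixes A :: "real^'n^'m"
  shows "norm (A *v x) \<le> norm A * norm x"
proof -
  have "(norm (A *v x))\<^sup>2 = (\<Sum>i\<in>UNIV. (row i A \<bullet> x)\<^sup>2)"
    by (simp add: norm_eq_sqrt_inner inner_vec_def matrix_vector_mult_def row_def
        power2_eq_square sum_nonneg)
  also have "\<dots> \<le> (\<Sum>i\<in>UNIV. (norm (A $ i))\<^sup>2 * (norm x)\<^sup>2)"
    by (intro sum_mono) (simp add: row_def Cauchy_Schwarz_ineq vec_lambda_eta power2_norm_eq_inner)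
  also have "\<dots> = (norm A * norm x)\<^sup>2"
    by (simp add: sum_distrib_right[symmetric] power_mult_distrib norm_vec_def L2_set_def sum_nonneg)
  finally show ?thesis
    by (rule power2_le_imp_le) simp
qed

lemma norm_transpose:
  fixes A :: "real^'n^'m"
  shows "norm (transpose A) = norm A"
proof -
  have "(\<Sum>i\<in>UNIV. \<Sum>j\<in>UNIV. (A $ j $ i)\<^sup>2) = (\<Sum>j\<in>UNIV. \<Sum>i\<in>UNIV. (A $ j $ i)\<^sup>2)"
    by (rule sum.swap)
  then show ?thesis
    by (simp add: norm_vec_def L2_set_def sum_nonneg transpose_def)
qed

lemma norm_matrix_le_sum_abs:
  fixes A :: "real^'n^'m"
  shows "norm A \<le> (\<Sum>i\<in>UNIV. \<Sum>j\<in>UNIV. \<bar>A $ i $ j\<bar>)"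
proof -
  have "norm A \<le> (\<Sum>i\<in>UNIV. norm (A $ i))"
    by (simp add: norm_vec_def[of A] L2_set_le_sum)
  also have "\<dots> \<le> (\<Sum>i\<in>UNIV. \<Sum>j\<in>UNIV. \<bar>A $ i $ j\<bar>)"
    by (intro sum_mono norm_le_l1_cart)
  finally show ?thesis .
qed

lemma inner_matrix_vector_mult:
  fixes A :: "real^'n^'m"
  shows "z \<bullet> (A *v u) = (transpose A *v z) \<bullet> u"
  by (simp add: dot_lmul_matrix[symmetric])

lemma norm_diff_scaleR_square:
  fixes u v :: "'a::real_inner"
  shows "(norm (u - s *\<^sub>R v))\<^sup>2 = (norm u)\<^sup>2 - 2 * s * (u \<bullet> v) + s\<^sup>2 * (norm v)\<^sup>2"
  unfolding power2_norm_eq_inner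
  by (simp add: inner_diff_left inner_diff_right inner_commute power2_eq_square algebra_simps)

text \<open>The minimum \<open>m\<close> of \<open>\<parallel>E\<^sup>T v\<parallel>\<^sup>2\<close> on the unit sphere is an eigenvalue of \<open>E E\<^sup>T\<close>, and multiplying an
  eigenvector by \<open>E\<^sup>T\<close> makes it one of \<open>E\<^sup>T E\<close>. Conversely an eigenvector \<open>v\<close> of \<open>E\<^sup>T E\<close> for \<open>c\<close>
  yields \<open>m \<parallel>E v\<parallel>\<^sup>2 \<le> \<parallel>E\<^sup>T E v\<parallel>\<^sup>2 = c \<parallel>E v\<parallel>\<^sup>2\<close>. So the least eigenvalue of
  \<open>E\<^sup>T E\<close> also bounds the transpose \<open>E\<^sup>T\<close> from below, which is the form that controls the
  multipliers.\<close>

lemma lambda_min_gram: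
  fixes E :: "real^'n^'n"
  assumes rank: "rank E = CARD('n)"
  shows "0 < lambda_min (transpose E ** E)"
    and "lambda_min (transpose E ** E) * (norm v)\<^sup>2 \<le> (norm (transpose E *v v))\<^sup>2"
proof -
  have inj: "E *v u = 0 \<Longrightarrow> u = 0" for u
    using rank full_rank_injective[of E] by (metis injD matrix_vector_mult_0_right)
  have injT: "transpose E *v u = 0 \<Longrightarrow> u = 0" for u
    using rank full_rank_injective[of "transpose E"] rank_transpose[of E]
    by (metis injD matrix_vector_mult_0_right)
  define B where "B = transpose E"
  define S where "S = sphere (0::real^'n) 1"
  have "compact S" "S \<noteq> {}"
    unfolding S_def by auto
  moreover have "continuous_on S (\<lambda>v. (norm (B *v v))\<^sup>2)"
    by (intro continuous_intros linear_continuous_on matrix_vector_mul_bounded_linear)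
  ultimately obtain w where w: "w \<in> S" "\<And>v. v \<in> S \<Longrightarrow> (norm (B *v w))\<^sup>2 \<le> (norm (B *v v))\<^sup>2"
    using continuous_attains_inf by metis
  define m where "m = (norm (B *v w))\<^sup>2"
  have norm_w: "norm w = 1"
    using w by (simp add: S_def)
  have m_pos: "0 < m"
    using injT[of w] norm_w unfolding m_def B_def[symmetric] by fastforce
  have lower: "m * (norm v)\<^sup>2 \<le> (norm (B *v v))\<^sup>2" for v
  proof (cases "v = 0")
    case False
    then have "v /\<^sub>R norm v \<in> S"
      by (simp add: S_def)
    from w(2)[OF this] False show ?thesis
      by (simp add: m_def matrix_vector_mult_scaleR power_mult_distrib field_simps)
  qed auto
  \<comment> \<open>First-order condition of the Rayleigh quotient at \<open>w\<close>: the quadratic form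
    \<open>v \<mapsto> \<parallel>B v\<parallel>\<^sup>2 - m \<parallel>v\<parallel>\<^sup>2\<close> is nonnegative and vanishes at \<open>w\<close>, so its gradient vanishes there.\<close>
  have "E *v (B *v w) = m *\<^sub>R w"
  proof -
    define d where "d = E *v (B *v w) - m *\<^sub>R w"
    define c where "c = (norm (B *v d))\<^sup>2 - m * (norm d)\<^sup>2"
    have adj: "(B *v w) \<bullet> (B *v d) = (E *v (B *v w)) \<bullet> d"
      by (metis B_def inner_commute inner_matrix_vector_mult transpose_transpose)
    have quad: "0 \<le> - 2 * s * (norm d)\<^sup>2 + s\<^sup>2 * c" for s
    proof -
      have "0 \<le> (norm (B *v (w - s *\<^sub>R d)))\<^sup>2 - m * (norm (w - s *\<^sub>R d))\<^sup>2"
        using lower[of "w - s *\<^sub>R d"] by simp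
      also have "(norm (B *v (w - s *\<^sub>R d)))\<^sup>2
          = m - 2 * s * ((B *v w) \<bullet> (B *v d)) + s\<^sup>2 * (norm (B *v d))\<^sup>2"
        by (simp add: m_def matrix_vector_mult_diff_distrib matrix_vector_mult_scaleR
            norm_diff_scaleR_square)
      also have "(norm (w - s *\<^sub>R d))\<^sup>2 = 1 - 2 * s * (w \<bullet> d) + s\<^sup>2 * (norm d)\<^sup>2"
        by (simp add: norm_w norm_diff_scaleR_square)
      also have "(norm d)\<^sup>2 = (E *v (B *v w)) \<bullet> d - m * (w \<bullet> d)"
        unfolding power2_norm_eq_inner by (subst (1) d_def) (simp add: inner_diff_left)
      finally show ?thesis
        unfolding c_def adj by (simp add: algebra_simps power2_norm_eq_inner d_def)
    qed
    have "(norm d)\<^sup>2 = 0"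
    proof (rule ccontr)
      assume ne: "(norm d)\<^sup>2 \<noteq> 0"
      define D where "D = (norm d)\<^sup>2"
      have D: "0 < D" using ne by (simp add: D_def)
      define s where "s = D / (\<bar>c\<bar> + 1)"
      have s: "0 < s" using D by (simp add: s_def)
      have "s\<^sup>2 * c \<le> s * (s * (\<bar>c\<bar> + 1))"
        using s by (simp add: power2_eq_square mult_left_mono)
      also have "\<dots> = s * D"
        by (simp add: s_def)
      finally have "s\<^sup>2 * c \<le> s * D" .
      with quad[of s] have "s * D \<le> 0" by (simp add: D_def)
      with s D show False by (simp add: mult_le_0_iff)
    qed
    then show ?thesis by (simp add: d_def)
  qed
  then have eig: "(B ** E) *v (B *v w) = m *\<^sub>R (B *v w)"
    by (simp add: matrix_vector_mul_assoc[symmetric] matrix_vector_mult_scaleR)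
  have "lambda_min (B ** E) = m"
    unfolding lambda_min_def
  proof (rule Least_equality)
    show "\<exists>v. v \<noteq> 0 \<and> (B ** E) *v v = m *\<^sub>R v"
      using eig m_pos by (intro exI[of _ "B *v w"]) (auto simp: m_def)
    fix c assume "\<exists>v. v \<noteq> 0 \<and> (B ** E) *v v = c *\<^sub>R v"
    then obtain v where v: "v \<noteq> 0" "B *v (E *v v) = c *\<^sub>R v"
      by (auto simp: matrix_vector_mul_assoc)
    have "m * (norm (E *v v))\<^sup>2 \<le> (B *v (E *v v)) \<bullet> (B *v (E *v v))"
      using lower[of "E *v v"] by (simp add: power2_norm_eq_inner)
    also have "\<dots> = c * (v \<bullet> (B *v (E *v v)))"
      by (subst (1) v) simp
    also have "v \<bullet> (B *v (E *v v)) = (norm (E *v v))\<^sup>2"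
      by (simp add: inner_matrix_vector_mult B_def power2_norm_eq_inner del: transpose_matrix_vector)
    finally have "m * (norm (E *v v))\<^sup>2 \<le> c * (norm (E *v v))\<^sup>2" .
    moreover have "0 < (norm (E *v v))\<^sup>2"
      using inj[of v] v(1) by auto
    ultimately show "m \<le> c"
      by (rule mult_right_le_imp_le)
  qed
  then show "0 < lambda_min (transpose E ** E)"
    and "lambda_min (transpose E ** E) * (norm v)\<^sup>2 \<le> (norm (transpose E *v v))\<^sup>2"
    using m_pos lower[of v] by (auto simp: B_def)
qed

section \<open>Almost sure behaviour of the sample means\<close>

lemma running_mean_minus:
  "1 \<le> n \<Longrightarrow> running_mean (\<lambda>i. s i - e) n = running_mean s n - e"
  by (simp add: running_mean_def sum_subtractf diff_divide_distrib)

lemma sample_mean_entry: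
  "sample_mean M \<theta> t $ a $ b = running_mean (\<lambda>i. M i $ a $ b) (\<theta> t)"
  by (simp add: sample_mean_def running_mean_def sum_component)

lemma sample_size_eq_power_schedule:
  assumes "0 < \<epsilon>"
  obtains p where "1 < p" "sample_size \<pi> \<epsilon> = power_schedule p"
proof
  let ?p = "if \<forall>i j. sub_gaussian \<pi> (\<lambda>A. A $ i $ j) then 1 + \<epsilon> else 2 + \<epsilon>"
  show "1 < ?p" using assms by simp
  show "sample_size \<pi> \<epsilon> = power_schedule ?p"
    by (rule ext) (simp add: sample_size_def power_schedule_def)
qed

lemma (in prob_space) indep_vars_expectation_mult:
  fixes X :: "'i \<Rightarrow> 'a \<Rightarrow> real"
  assumes "indep_vars (\<lambda>_. borel) X I" "i \<in> I" "j \<in> I" "i \<noteq> j"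
    and "integrable M (X i)" "integrable M (X j)"
  shows "integrable M (\<lambda>\<omega>. X i \<omega> * X j \<omega>)"
    and "expectation (\<lambda>\<omega>. X i \<omega> * X j \<omega>) = expectation (X i) * expectation (X j)"
proof -
  have ind: "indep_vars (\<lambda>_. borel) X {i, j}"
    using assms by (intro indep_vars_subset[OF assms(1)]) auto
  have int: "integrable M (X k)" if "k \<in> {i, j}" for k
    using that assms by auto
  from indep_vars_integrable[OF _ ind int] indep_vars_lebesgue_integral[OF _ ind int] \<open>i \<noteq> j\<close>
  show "integrable M (\<lambda>\<omega>. X i \<omega> * X j \<omega>)"
    and "expectation (\<lambda>\<omega>. X i \<omega> * X j \<omega>) = expectation (X i) * expectation (X j)"
    by simp_all
qed

text \<open>The estimate for running means is applied to each entry of the matrices, centred at its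
  expectation.\<close>

lemma sample_mean_convergence:
  fixes M :: "nat \<Rightarrow> 'w \<Rightarrow> real^'n^'m" and \<pi> :: "(real^'n^'m) measure"
  assumes \<Omega>: "prob_space \<Omega>"
    and indep: "prob_space.indep_vars \<Omega> (\<lambda>_. borel) M {1..}"
    and distr: "\<And>i. i \<ge> 1 \<Longrightarrow> distr \<Omega> borel (M i) = \<pi>"
    and var: "finite_entrywise_variance \<pi>"
    and \<epsilon>: "0 < \<epsilon>"
  defines "A \<equiv> \<lambda>\<omega>. sample_mean (\<lambda>i. M i \<omega>) (sample_size \<pi> \<epsilon>)"
  shows "AE \<omega> in \<Omega>. A \<omega> \<longlonglongrightarrow> mean_matrix \<pi> \<and> summable (\<lambda>t. norm (A \<omega> (Suc t) - A \<omega> t))"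
proof -
  interpret prob_space \<Omega> by fact
  obtain p where p: "1 < p" "sample_size \<pi> \<epsilon> = power_schedule p"
    by (rule sample_size_eq_power_schedule[OF \<epsilon>])
  have M_meas: "M i \<in> borel_measurable \<Omega>" if "1 \<le> i" for i
    using indep that by (auto simp: indep_vars_def)
  have "AE \<omega> in \<Omega>. (\<lambda>t. A \<omega> t $ a $ b) \<longlonglongrightarrow> mean_matrix \<pi> $ a $ b
          \<and> summable (\<lambda>t. \<bar>A \<omega> (Suc t) $ a $ b - A \<omega> t $ a $ b\<bar>)" for a b
  proof -
    define e where "e = mean_matrix \<pi> $ a $ b"
    define X where "X i \<omega> = M i \<omega> $ a $ b - e" for i \<omega>
    define V where "V = (\<integral>A. (A $ a $ b - e) * (A $ a $ b - e) \<partial>\<pi>)"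
    define S where "S t \<omega> = running_mean (\<lambda>i. X i \<omega>) (power_schedule p t)" for t \<omega>
    have entry[measurable]: "(\<lambda>A::real^'n^'m. A $ a $ b) \<in> borel_measurable borel"
      by (intro borel_measurable_continuous_onI continuous_intros)
    have X_meas: "X i \<in> borel_measurable \<Omega>" if "1 \<le> i" for i
      unfolding X_def using measurable_compose[OF M_meas[OF that] entry] by measurable
    have \<pi>_sets: "sets \<pi> = sets borel"
      using distr[of 1] by auto
    have \<pi>_prob: "prob_space \<pi>"
      using prob_space_distr[OF M_meas[of 1]] distr[of 1] by simp
    interpret \<pi>: prob_space \<pi> by (rule \<pi>_prob)
    have \<pi>_int: "integrable \<pi> (\<lambda>A. A $ a $ b)" "integrable \<pi> (\<lambda>A. (A $ a $ b)\<^sup>2)"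
      using var by (auto simp: finite_entrywise_variance_def)
    have \<pi>_sq: "integrable \<pi> (\<lambda>A. (A $ a $ b - e) * (A $ a $ b - e))"
      using \<pi>_int by (simp add: algebra_simps power2_eq_square)
    have transfer: "integrable \<Omega> (\<lambda>\<omega>. f (M i \<omega>))" "(\<integral>\<omega>. f (M i \<omega>) \<partial>\<Omega>) = (\<integral>A. f A \<partial>\<pi>)"
      if "1 \<le> i" "integrable \<pi> f" for i and f :: "real^'n^'m \<Rightarrow> real"
    proof -
      have f: "f \<in> borel_measurable borel"
        using borel_measurable_integrable[OF that(2)] measurable_cong_sets[OF \<pi>_sets refl] by auto
      show "integrable \<Omega> (\<lambda>\<omega>. f (M i \<omega>))"
        using that integrable_distr_eq[OF M_meas[OF that(1)] f] distr[OF that(1)] by simp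
      show "(\<integral>\<omega>. f (M i \<omega>) \<partial>\<Omega>) = (\<integral>A. f A \<partial>\<pi>)"
        using that integral_distr[OF M_meas[OF that(1)] f] distr[OF that(1)] by simp
    qed
    have X_int: "integrable \<Omega> (X i)" and X_mean: "expectation (X i) = 0" if "1 \<le> i" for i
    proof -
      have "integrable \<pi> (\<lambda>A. A $ a $ b - e)" "(\<integral>A. A $ a $ b - e \<partial>\<pi>) = 0"
        using \<pi>_int by (auto simp: e_def mean_matrix_def \<pi>.prob_space)
      with transfer[OF that, of "\<lambda>A. A $ a $ b - e"]
      show "integrable \<Omega> (X i)" "expectation (X i) = 0"
        by (simp_all add: X_def[abs_def])
    qed
    have X_sq: "integrable \<Omega> (\<lambda>\<omega>. X i \<omega> * X i \<omega>)" "expectation (\<lambda>\<omega>. X i \<omega> * X i \<omega>) = V"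
      if "1 \<le> i" for i
      using transfer[OF that \<pi>_sq] by (simp_all add: X_def V_def)
    have X_indep: "indep_vars (\<lambda>_. borel) X {1..}"
      using indep_vars_compose2[OF indep, of "\<lambda>_ A. A $ a $ b - e" "\<lambda>_. borel"]
      by (simp add: X_def[abs_def])
    have int: "integrable \<Omega> (\<lambda>\<omega>. X i \<omega> * X j \<omega>)" if "1 \<le> i" "1 \<le> j" for i j
      using that X_sq(1)[of i] indep_vars_expectation_mult(1)[OF X_indep, of i j] X_int
      by (cases "i = j") auto
    have orth: "expectation (\<lambda>\<omega>. X i \<omega> * X j \<omega>) = 0" if "1 \<le> i" "1 \<le> j" "i \<noteq> j" for i j
      using that indep_vars_expectation_mult(2)[OF X_indep, of i j] X_int X_mean by auto
    have S: "AE \<omega> in \<Omega>. (\<lambda>t. S t \<omega>) \<longlonglongrightarrow> 0"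
        "AE \<omega> in \<Omega>. summable (\<lambda>t. \<bar>S (Suc t) \<omega> - S t \<omega>\<bar>)"
      unfolding S_def
      by (intro running_mean_along_power_schedule[where V = V] X_meas int orth X_sq(2) p(1); assumption)+
    have A_eq: "A \<omega> t $ a $ b = S t \<omega> + e" if "1 \<le> t" for t \<omega>
      using that unfolding A_def S_def X_def sample_mean_entry p(2)
      by (subst running_mean_minus[OF power_schedule_pos[OF that]]) simp
    show ?thesis
      using S(1) S(2)
    proof eventually_elim
      case (elim \<omega>)
      have "(\<lambda>t. S (Suc t) \<omega> + e) \<longlonglongrightarrow> 0 + e"
        by (intro tendsto_intros LIMSEQ_Suc elim)
      then have "(\<lambda>t. A \<omega> (Suc t) $ a $ b) \<longlonglongrightarrow> e"
        by (simp add: A_eq)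
      then have "(\<lambda>t. A \<omega> t $ a $ b) \<longlonglongrightarrow> e"
        by (rule LIMSEQ_imp_Suc)
      moreover have "summable (\<lambda>t. \<bar>S (Suc (Suc t)) \<omega> - S (Suc t) \<omega>\<bar>)"
        using elim(2) by (subst summable_Suc_iff)
      then have "summable (\<lambda>t. \<bar>A \<omega> (Suc (Suc t)) $ a $ b - A \<omega> (Suc t) $ a $ b\<bar>)"
        by (simp add: A_eq)
      then have "summable (\<lambda>t. \<bar>A \<omega> (Suc t) $ a $ b - A \<omega> t $ a $ b\<bar>)"
        by (subst (asm) summable_Suc_iff)
      ultimately show ?case
        by (simp add: e_def)
    qed
  qed
  then have "AE \<omega> in \<Omega>. \<forall>a b. (\<lambda>t. A \<omega> t $ a $ b) \<longlonglongrightarrow> mean_matrix \<pi> $ a $ b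
          \<and> summable (\<lambda>t. \<bar>A \<omega> (Suc t) $ a $ b - A \<omega> t $ a $ b\<bar>)"
    by (simp add: AE_all_countable)
  then show ?thesis
  proof eventually_elim
    case (elim \<omega>)
    have "A \<omega> \<longlonglongrightarrow> mean_matrix \<pi>"
      using elim by (intro vec_tendstoI) blast
    moreover have "summable (\<lambda>t. norm (A \<omega> (Suc t) - A \<omega> t))"
    proof (rule summable_comparison_test')
      show "summable (\<lambda>t. \<Sum>a\<in>UNIV. \<Sum>b\<in>UNIV. \<bar>A \<omega> (Suc t) $ a $ b - A \<omega> t $ a $ b\<bar>)"
        using elim by (intro summable_sum) blast
      show "norm (norm (A \<omega> (Suc t) - A \<omega> t))
          \<le> (\<Sum>a\<in>UNIV. \<Sum>b\<in>UNIV. \<bar>A \<omega> (Suc t) $ a $ b - A \<omega> t $ a $ b\<bar>)" for t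
        using norm_matrix_le_sum_abs[of "A \<omega> (Suc t) - A \<omega> t"] by simp
    qed
    ultimately show ?case ..
  qed
qed

section \<open>Convexity, semicontinuity and subgradients\<close>

lemma convex_above_tangent:
  fixes \<phi> :: "'a::real_inner \<Rightarrow> real"
  assumes convex: "convex_on UNIV \<phi>" and deriv: "GDERIV \<phi> x :> g"
  shows "\<phi> x + g \<bullet> (u - x) \<le> \<phi> u"
proof -
  define f where "f s = \<phi> (x + s *\<^sub>R (u - x))" for s
  have "convex_on UNIV f"
  proof (rule convex_onI)
    fix t a b :: real assume t: "0 < t" "t < 1"
    have "f ((1 - t) *\<^sub>R a + t *\<^sub>R b)
        = \<phi> ((1 - t) *\<^sub>R (x + a *\<^sub>R (u - x)) + t *\<^sub>R (x + b *\<^sub>R (u - x)))"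
      unfolding f_def by (rule arg_cong[of _ _ \<phi>]) (simp add: algebra_simps)
    also have "\<dots> \<le> (1 - t) * f a + t * f b"
      unfolding f_def using t by (intro convex_onD[OF convex]) auto
    finally show "f ((1 - t) *\<^sub>R a + t *\<^sub>R b) \<le> (1 - t) * f a + t * f b" .
  qed auto
  moreover have "(f has_real_derivative g \<bullet> (u - x)) (at 0)"
  proof -
    have "((\<lambda>s. x + s *\<^sub>R (u - x)) has_derivative (\<lambda>s. s *\<^sub>R (u - x))) (at 0)"
      by (auto intro!: derivative_eq_intros)
    moreover have "(\<phi> has_derivative (\<lambda>v. v \<bullet> g)) (at (x + 0 *\<^sub>R (u - x)))"
      using deriv by (simp add: gderiv_def)
    ultimately have "(f has_derivative (\<lambda>s. (s *\<^sub>R (u - x)) \<bullet> g)) (at 0)"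
      unfolding f_def by (rule has_derivative_compose)
    then show ?thesis
      by (simp add: has_field_derivative_def inner_commute mult_commute_abs)
  qed
  ultimately have "g \<bullet> (u - x) * (1 - 0) \<le> f 1 - f 0"
    by (intro convex_on_imp_above_tangent[of UNIV]) auto
  then show ?thesis
    by (simp add: f_def)
qed

lemma lower_semicontinuous_liminf:
  assumes lsc: "lower_semicontinuous P" and lim: "ys \<longlonglongrightarrow> y"
  shows "P y \<le> liminf (\<lambda>k. P (ys k))"
proof (subst le_Liminf_iff, intro allI impI)
  fix c assume c: "c < P y"
  have "P y \<le> Liminf (at y) P"
    using lsc by (simp add: lower_semicontinuous_def)
  then have "\<forall>\<^sub>F u in at y. c < P u"
    using c unfolding le_Liminf_iff by blast
  then have "\<forall>\<^sub>F u in nhds y. c < P u"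
    using c by (auto simp: eventually_at_filter elim: eventually_mono)
  then show "\<forall>\<^sub>F k in sequentially. c < P (ys k)"
    using lim by (rule eventually_compose_filterlim)
qed

text \<open>The constant \<open>m\<close> is the minimal value of the proximal problem with \<open>\<mu> = 1\<close> and centre
  \<open>0\<close>. The bound is uniform on bounded sets, in particular on bounded iterates.\<close>

lemma prox_tractable_lower_bound:
  fixes P :: "'a::real_normed_vector \<Rightarrow> ereal"
  assumes "proper P" "prox_tractable P"
  obtains m where "\<And>v. ereal (m - (norm v)\<^sup>2 / 2) \<le> P v"
proof -
  have "argmin (\<lambda>v. P v + ereal (1 / (2 * 1) * (norm (v - 0))\<^sup>2)) \<noteq> {}"
    using assms(2) unfolding prox_tractable_def by (metis zero_less_one)
  then obtain w where w: "P w + ereal ((norm w)\<^sup>2 / 2) \<le> P v + ereal ((norm v)\<^sup>2 / 2)" for v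
    by (auto simp: argmin_def is_arg_min_def not_less)
  from assms(1) obtain a where a: "P a \<noteq> \<infinity>" "\<And>v. P v \<noteq> -\<infinity>"
    by (auto simp: proper_def)
  have "P w \<noteq> \<infinity>"
    using w[of a] a by (cases "P a") auto
  then obtain r where r: "P w = ereal r"
    using a(2)[of w] by (cases "P w") auto
  have "ereal (r + (norm w)\<^sup>2 / 2 - (norm v)\<^sup>2 / 2) \<le> P v" for v
    using w[of v] a(2)[of v] by (cases "P v") (auto simp: r)
  then show thesis
    by (rule that)
qed

text \<open>A minimiser of \<open>P + f + g\<close> lies in the domain of a proper \<open>P\<close>, so the comparison of
  values can afterwards be made in the reals.\<close>

lemma argmin_perturbed_finite:
  assumes "proper P" and "u \<in> argmin (\<lambda>v. P v + ereal (f v) + ereal (g v))"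
  shows "\<bar>P u\<bar> \<noteq> \<infinity>" and "P u + ereal (f u + g u) \<le> P v + ereal (f v + g v)"
proof -
  have assoc: "P v + ereal (f v) + ereal (g v) = P v + ereal (f v + g v)" for v
    by (simp add: add.assoc)
  have le: "P u + ereal (f u + g u) \<le> P v + ereal (f v + g v)" for v
    using assms(2) by (auto simp: argmin_def is_arg_min_def not_less assoc)
  then show "P u + ereal (f u + g u) \<le> P v + ereal (f v + g v)" .
  from assms(1) obtain a where a: "P a \<noteq> \<infinity>" "\<And>v. P v \<noteq> -\<infinity>"
    by (auto simp: proper_def)
  show "\<bar>P u\<bar> \<noteq> \<infinity>"
    using le[of a] a a(2)[of u] by (cases "P a"; cases "P u") auto
qed

lemma empirical_lipschitz_bound:
  assumes "empirical_lipschitz F x \<noteq> \<infinity>"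
  obtains L where "empirical_lipschitz F x = ereal L"
    "\<And>t. norm (F (x (Suc t)) - F (x t)) \<le> L * norm (x (Suc t) - x t)"
proof (cases "\<forall>t. x (Suc t) = x t")
  case True
  then have "empirical_lipschitz F x = 0"
    by (simp add: empirical_lipschitz_def)
  with True show thesis
    by (intro that[of 0]) (simp_all add: zero_ereal_def)
next
  case False
  let ?q = "\<lambda>t. norm (F (x (Suc t)) - F (x t)) / norm (x (Suc t) - x t)"
  have eq: "empirical_lipschitz F x = (SUP t\<in>{t. x (Suc t) \<noteq> x t}. ereal (?q t))"
    using False unfolding empirical_lipschitz_def by (rule if_not_P)
  have le: "ereal (?q t) \<le> empirical_lipschitz F x" if "x (Suc t) \<noteq> x t" for t
    unfolding eq using that by (intro SUP_upper) auto
  from False obtain t0 where t0: "x (Suc t0) \<noteq> x t0" by auto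
  have "0 \<le> ereal (?q t0)" by simp
  also note le[OF t0]
  finally have "0 \<le> empirical_lipschitz F x" .
  then obtain L where L: "0 \<le> L" "empirical_lipschitz F x = ereal L"
    using assms by (cases "empirical_lipschitz F x") auto
  have "norm (F (x (Suc t)) - F (x t)) \<le> L * norm (x (Suc t) - x t)" for t
    using le[of t] L by (cases "x (Suc t) = x t") (auto simp: field_simps)
  with L(2) show thesis
    by (rule that)
qed

text \<open>Telescoping: the total decrease of \<open>u\<close> is at most \<open>u 0 - m\<close> plus everything that the
  errors \<open>e\<close> give back.\<close>

lemma summable_of_almost_descent:
  fixes u s e :: "nat \<Rightarrow> real"
  assumes descent: "\<And>t. u (Suc t) \<le> u t - s t + e t"
    and s: "\<And>t. 0 \<le> s t" and lower: "\<And>t. m \<le> u t"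
    and e: "\<And>t. 0 \<le> e t" "summable e"
  shows "summable s"
proof (rule summableI_nonneg_bounded)
  fix n
  have "(\<Sum>t<n. s t) \<le> u 0 - u n + (\<Sum>t<n. e t)"
  proof (induction n)
    case (Suc n)
    then show ?case using descent[of n] by simp
  qed simp
  also have "\<dots> \<le> u 0 - m + suminf e"
    using lower[of n] sum_le_suminf[OF e(2), of "{..<n}"] e(1) by auto
  finally show "(\<Sum>t<n. s t) \<le> u 0 - m + suminf e" .
qed (rule s)

lemma tendsto_matrix_vector_mult:
  fixes A :: "'b \<Rightarrow> real^'n^'m"
  assumes "(A \<longlongrightarrow> A') F" "(x \<longlongrightarrow> x') F"
  shows "((\<lambda>t. A t *v x t) \<longlongrightarrow> A' *v x') F"
  unfolding matrix_vector_mult_def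
  by (intro vec_tendstoI) (auto intro!: tendsto_intros assms)

lemma tendsto_transpose:
  fixes A :: "'b \<Rightarrow> real^'n^'m"
  assumes "(A \<longlongrightarrow> A') F"
  shows "((\<lambda>t. transpose (A t)) \<longlongrightarrow> transpose A') F"
  unfolding transpose_def
  by (intro vec_tendstoI) (auto intro!: tendsto_intros assms)

lemma transpose_diff:
  fixes A C :: "real^'n^'m"
  shows "transpose (A - C) = transpose A - transpose C"
  by (simp add: transpose_def vec_eq_iff)

text \<open>A quadratic minorant of \<open>P\<close> touching at \<open>E u\<close> with slope \<open>w\<close> is a Frechet subgradient
  certificate, since the quadratic term is \<open>o(\<parallel>v - u\<parallel>)\<close>. Pulling it back along \<open>E\<close> and adding
  the smooth \<open>h\<close> costs only \<open>o(\<parallel>v - u\<parallel>)\<close> as well.\<close>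

lemma frechet_subgradient_composite:
  fixes E :: "real^'n^'m"
  assumes h: "GDERIV h u :> g"
    and fin: "\<bar>P (E *v u)\<bar> \<noteq> \<infinity>"
    and minorant: "\<And>v. P (E *v u) + ereal (w \<bullet> (v - E *v u) - c * (norm (v - E *v u))\<^sup>2) \<le> P v"
  defines "F \<equiv> \<lambda>v. ereal (h v) + P (E *v v)"
  shows "0 \<le> Liminf (at u) (\<lambda>v. (F v - F u - ereal ((g + transpose E *v w) \<bullet> (v - u)))
                                   / ereal (norm (v - u)))"
proof -
  define q where "q v = (h v - h u - (v - u) \<bullet> g) / norm (v - u)
                          - c * (norm (E *v (v - u)))\<^sup>2 / norm (v - u)" for v
  have "((\<lambda>v. norm (h v - h u - (v - u) \<bullet> g) / norm (v - u)) \<longlongrightarrow> 0) (at u)"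
    using h by (simp add: gderiv_def has_derivative_iff_norm)
  then have lim1: "((\<lambda>v. (h v - h u - (v - u) \<bullet> g) / norm (v - u)) \<longlongrightarrow> 0) (at u)"
    by (intro tendsto_rabs_zero_cancel[where f = "\<lambda>v. (h v - h u - (v - u) \<bullet> g) / norm (v - u)"])
       (simp add: abs_divide)
  have lim2: "((\<lambda>v. c * (norm (E *v (v - u)))\<^sup>2 / norm (v - u)) \<longlongrightarrow> 0) (at u)"
  proof (rule Lim_null_comparison)
    have "((\<lambda>v. \<bar>c\<bar> * ((norm E)\<^sup>2 * norm (v - u))) \<longlongrightarrow> \<bar>c\<bar> * ((norm E)\<^sup>2 * norm (u - u))) (at u)"
      by (intro tendsto_intros)
    then show "((\<lambda>v. \<bar>c\<bar> * ((norm E)\<^sup>2 * norm (v - u))) \<longlongrightarrow> 0) (at u)"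
      by simp
    have "norm (c * (norm (E *v (v - u)))\<^sup>2 / norm (v - u)) \<le> \<bar>c\<bar> * ((norm E)\<^sup>2 * norm (v - u))"
      if "v \<noteq> u" for v
    proof -
      have "(norm (E *v (v - u)))\<^sup>2 \<le> (norm E * norm (v - u))\<^sup>2"
        by (intro power_mono norm_matrix_vector_mult_le) simp
      then have "(norm (E *v (v - u)))\<^sup>2 / norm (v - u) \<le> (norm E)\<^sup>2 * norm (v - u)"
        using that by (simp add: divide_simps power2_eq_square mult_ac)
      from mult_left_mono[OF this abs_ge_zero[of c]] show ?thesis
        by (simp add: abs_mult)
    qed
    then show "\<forall>\<^sub>F v in at u. norm (c * (norm (E *v (v - u)))\<^sup>2 / norm (v - u))
        \<le> \<bar>c\<bar> * ((norm E)\<^sup>2 * norm (v - u))"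
      by (auto simp: eventually_at_filter)
  qed
  have "((\<lambda>v. ereal (q v)) \<longlongrightarrow> 0) (at u)"
    using tendsto_diff[OF lim1 lim2] by (simp add: q_def zero_ereal_def)
  then have "Liminf (at u) (\<lambda>v. ereal (q v)) = 0"
    by (intro lim_imp_Liminf) auto
  moreover have "ereal (q v) \<le> (F v - F u - ereal ((g + transpose E *v w) \<bullet> (v - u))) / ereal (norm (v - u))"
    if "v \<noteq> u" for v
  proof -
    obtain p where p: "P (E *v u) = ereal p"
      using fin by (cases "P (E *v u)") auto
    have min: "ereal (p + w \<bullet> (E *v (v - u)) - c * (norm (E *v (v - u)))\<^sup>2) \<le> P (E *v v)"
      using minorant[of "E *v v"] by (simp add: p matrix_vector_mult_diff_distrib add_diff_eq)
    show ?thesis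
    proof (cases "P (E *v v)")
      case (real r)
      have "q v = (h v - h u - (v - u) \<bullet> g - c * (norm (E *v (v - u)))\<^sup>2) / norm (v - u)"
        by (simp add: q_def diff_divide_distrib)
      also have "\<dots> \<le> (h v + r - (h u + p) - (g + transpose E *v w) \<bullet> (v - u)) / norm (v - u)"
        using min unfolding real inner_matrix_vector_mult
        by (intro divide_right_mono)
           (simp_all add: inner_add_left inner_commute[of g] del: transpose_matrix_vector)
      finally show ?thesis
        using that by (simp add: F_def p real)
    qed (use min that in \<open>auto simp: F_def p\<close>)
  qed
  then have "Liminf (at u) (\<lambda>v. ereal (q v)) \<le>
    Liminf (at u) (\<lambda>v. (F v - F u - ereal ((g + transpose E *v w) \<bullet> (v - u))) / ereal (norm (v - u)))"
    by (intro Liminf_mono) (auto simp: eventually_at_filter)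
  ultimately show ?thesis by simp
qed

section \<open>The descent argument along one sample path\<close>

text \<open>One sample path on which the sample means converge, with the constants of the penalty
  oracle made explicit: \<open>b\<close> is the final penalty and \<open>L1\<close>, \<open>L2\<close> bound
  the difference quotients behind the two empirical Lipschitz constants. The bounds start at time \<open>1\<close> because \<open>y 0\<close> is arbitrary.\<close>

locale isad_run =
  fixes h \<phi> :: "real^'n \<Rightarrow> real" and gh gp :: "real^'n \<Rightarrow> real^'n"
    and P :: "real^'n \<Rightarrow> ereal"
    and E :: "real^'n^'n" and A :: "nat \<Rightarrow> real^'n^'n"
    and x y z :: "nat \<Rightarrow> real^'n" and x0 z0 :: "real^'n" and \<beta> :: "nat \<Rightarrow> real"
    and \<sigma> b \<beta>0 \<rho> L1 L2 B :: real and K :: nat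
  assumes h_grad: "\<And>u. GDERIV h u :> gh u" and gh_cont: "continuous_on UNIV gh"
    and \<phi>_convex: "convex_on UNIV \<phi>" and \<phi>_grad: "\<And>u. GDERIV \<phi> u :> gp u"
    and P_proper: "proper P" and P_lsc: "lower_semicontinuous P" and P_prox: "prox_tractable P"
    and full_rank: "rank E = CARD('n)"
    and A_lim: "A \<longlonglongrightarrow> E" and A_sum: "summable (\<lambda>t. norm (A (Suc t) - A t))"
    and run: "meta_isad h P \<phi> A x0 z0 \<beta>0 x y z \<beta>"
    and \<sigma>: "\<sigma> = lambda_min (transpose E ** E)"
    and b: "0 < b" and \<beta>_tail: "\<And>t. K < t \<Longrightarrow> \<beta> t = b"
    and descent: "\<And>t. K < t \<Longrightarrow>
      x_objective h \<phi> A x y z \<beta> t (x (Suc t)) - x_objective h \<phi> A x y z \<beta> t (x t)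
        \<le> - (\<rho> / 2) * (norm (x (Suc t) - x t))\<^sup>2"
    and gap: "8 / (b * \<sigma>) * (L1\<^sup>2 + L2\<^sup>2) < \<rho>"
    and lip1: "\<And>t. norm ((gh (x (Suc t)) + gp (x (Suc t))) - (gh (x t) + gp (x t)))
                      \<le> L1 * norm (x (Suc t) - x t)"
    and lip2: "\<And>t. norm (gp (x (Suc t)) - gp (x t)) \<le> L2 * norm (x (Suc t) - x t)"
    and bounds: "\<And>t. 0 < t \<Longrightarrow> norm (x t) \<le> B" "\<And>t. 0 < t \<Longrightarrow> norm (y t) \<le> B"
      "\<And>t. 0 < t \<Longrightarrow> norm (z t) \<le> B" "\<And>t. norm (A t) \<le> B"
begin

lemma \<sigma>_pos: "0 < \<sigma>"
  unfolding \<sigma> using full_rank by (rule lambda_min_gram)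

lemma \<sigma>_le: "\<sigma> * (norm v)\<^sup>2 \<le> (norm (transpose E *v v))\<^sup>2"
  unfolding \<sigma> using full_rank by (rule lambda_min_gram)

lemma B_nonneg: "0 \<le> B"
  using bounds(4)[of 0] norm_ge_zero by (rule order_trans[rotated])

lemma y_argmin:
  "y (Suc t) \<in> argmin (\<lambda>u. P u + ereal (z t \<bullet> u)
                          + ereal (\<beta> t / 2 * (norm (A (Suc t) *v x t - u))\<^sup>2))"
  using run by (simp add: meta_isad_def)

lemma z_update:
  assumes "K < t"
  shows "z (Suc t) = z t - b *\<^sub>R (A (Suc t) *v x (Suc t) - y (Suc t))"
  using run \<beta>_tail[OF assms] by (simp add: meta_isad_def)

lemma P_y_finite: "0 < t \<Longrightarrow> \<bar>P (y t)\<bar> \<noteq> \<infinity>"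
  using argmin_perturbed_finite(1)[OF P_proper y_argmin] by (cases t) auto

text \<open>The optimality condition of the \<open>x\<close>-step, in which the multiplier update absorbs the penalty
  term. It expresses \<open>A\<^sup>T z\<close> by two consecutive iterates \<open>x\<close>, whence dual steps can be
  bounded by primal steps.\<close>

lemma dual_stationarity:
  assumes t: "K < t"
  shows "transpose (A (Suc t)) *v z (Suc t) = gh (x (Suc t)) + gp (x (Suc t)) - gp (x t)"
proof -
  let ?A = "A (Suc t)" and ?x = "x (Suc t)"
  let ?r = "?A *v ?x - y (Suc t)"
  let ?g = "gh ?x - transpose ?A *v z t + b *\<^sub>R (transpose ?A *v ?r) + (gp ?x - gp (x t))"
  have lin: "((\<lambda>u. ?A *v u) has_derivative (\<lambda>v. ?A *v v)) (at ?x)"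
    by (intro bounded_linear_imp_has_derivative matrix_vector_mul_bounded_linear)
  have "(h has_derivative (\<lambda>v. v \<bullet> gh ?x)) (at ?x)" "(\<phi> has_derivative (\<lambda>v. v \<bullet> gp ?x)) (at ?x)"
    using h_grad \<phi>_grad by (simp_all add: gderiv_def)
  then have "(x_objective h \<phi> A x y z \<beta> t has_derivative
     (\<lambda>v. v \<bullet> gh ?x - z t \<bullet> (?A *v v) + b / 2 * (2 * (?r \<bullet> (?A *v v)))
        + (v \<bullet> gp ?x - gp (x t) \<bullet> v))) (at ?x)"
    unfolding x_objective_def[abs_def] bregman_def \<beta>_tail[OF t] grad_eqI[OF \<phi>_grad] power2_norm_eq_inner
    by (auto intro!: derivative_eq_intros lin simp: inner_commute)
  moreover have "(\<lambda>v. v \<bullet> gh ?x - z t \<bullet> (?A *v v) + b / 2 * (2 * (?r \<bullet> (?A *v v)))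
        + (v \<bullet> gp ?x - gp (x t) \<bullet> v)) = (\<lambda>v. v \<bullet> ?g)"
    unfolding inner_matrix_vector_mult
    by (simp add: inner_add_right inner_diff_right inner_commute del: transpose_matrix_vector)
  ultimately have "GDERIV (x_objective h \<phi> A x y z \<beta> t) ?x :> ?g"
    by (simp add: gderiv_def)
  moreover have "GDERIV (x_objective h \<phi> A x y z \<beta> t) ?x :> 0"
    using run by (simp add: meta_isad_def)
  ultimately have "?g = 0"
    using grad_eqI by metis
  moreover have "transpose ?A *v z (Suc t) = transpose ?A *v z t - b *\<^sub>R (transpose ?A *v ?r)"
    unfolding z_update[OF t]
    by (simp add: matrix_vector_mult_diff_distrib matrix_vector_mult_scaleR del: transpose_matrix_vector)
  moreover have "w = a + p - p'" if "a - s + q + (p - p') = 0" "w = s - q"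
    for a p p' q s w :: "real^'n"
  proof -
    have "w + (a - s + q + (p - p')) = a + p - p'"
      unfolding that(2) by simp
    then show ?thesis
      using that(1) by simp
  qed
  ultimately show ?thesis
    by blast
qed

text \<open>The matrix is an argument because it changes from one iteration to the next. The value of
  \<open>P\<close> is converted to a real number; on the iterates it is finite.\<close>

definition aug_lagrangian :: "real^'n^'n \<Rightarrow> real^'n \<Rightarrow> real^'n \<Rightarrow> real^'n \<Rightarrow> real" where
  "aug_lagrangian C u v w = h u + real_of_ereal (P v) - w \<bullet> (C *v u - v) + b / 2 * (norm (C *v u - v))\<^sup>2"

lemma y_step_descent:
  assumes t: "K < t"
  shows "aug_lagrangian (A (Suc t)) (x t) (y (Suc t)) (z t)
           \<le> aug_lagrangian (A (Suc t)) (x t) (y t) (z t)"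
proof -
  have "P (y (Suc t)) + ereal (z t \<bullet> y (Suc t) + \<beta> t / 2 * (norm (A (Suc t) *v x t - y (Suc t)))\<^sup>2)
      \<le> P (y t) + ereal (z t \<bullet> y t + \<beta> t / 2 * (norm (A (Suc t) *v x t - y t))\<^sup>2)"
    by (rule argmin_perturbed_finite(2)[OF P_proper y_argmin])
  with P_y_finite[of t] P_y_finite[of "Suc t"] t \<beta>_tail[OF t] show ?thesis
    by (cases "P (y t)"; cases "P (y (Suc t))") (auto simp: aug_lagrangian_def inner_diff_right)
qed

lemma x_step_descent:
  assumes t: "K < t"
  shows "aug_lagrangian (A (Suc t)) (x (Suc t)) (y (Suc t)) (z t)
           \<le> aug_lagrangian (A (Suc t)) (x t) (y (Suc t)) (z t) - \<rho> / 2 * (norm (x (Suc t) - x t))\<^sup>2"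
proof -
  have "0 \<le> bregman \<phi> (x (Suc t)) (x t)"
    using convex_above_tangent[OF \<phi>_convex \<phi>_grad[of "x t"], of "x (Suc t)"]
    by (simp add: bregman_def grad_eqI[OF \<phi>_grad])
  moreover have "bregman \<phi> (x t) (x t) = 0"
    by (simp add: bregman_def)
  ultimately show ?thesis
    using descent[OF t] \<beta>_tail[OF t] by (simp add: aug_lagrangian_def x_objective_def inner_diff_right)
qed

text \<open>Of the three updates only this one increases the augmented Lagrangian. The increase is
  compensated by the decrease of the \<open>x\<close>-step.\<close>

lemma z_step_ascent:
  assumes t: "K < t"
  shows "aug_lagrangian (A (Suc t)) (x (Suc t)) (y (Suc t)) (z (Suc t))
           = aug_lagrangian (A (Suc t)) (x (Suc t)) (y (Suc t)) (z t) + (norm (z (Suc t) - z t))\<^sup>2 / b"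
  using b unfolding aug_lagrangian_def z_update[OF t]
  by (simp add: inner_diff_left power2_norm_eq_inner[symmetric] power_mult_distrib power2_eq_square)

text \<open>A Lipschitz constant, in the matrix argument, of the augmented Lagrangian on the ball of radius \<open>B\<close>.\<close>

definition drift :: real where
  "drift = B\<^sup>2 + b * B * (B\<^sup>2 + B)"

lemma drift_nonneg: "0 \<le> drift"
  unfolding drift_def using B_nonneg b by simp

lemma norm_residual_le:
  assumes "norm (C :: real^'n^'n) \<le> B" "norm u \<le> B" "norm v \<le> B"
  shows "norm (C *v u - v) \<le> B\<^sup>2 + B"
proof -
  have "norm (C *v u - v) \<le> norm C * norm u + norm v"
    using norm_triangle_ineq4[of "C *v u" v] norm_matrix_vector_mult_le[of C u] by linarith
  also have "\<dots> \<le> B * B + B"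
    using assms B_nonneg by (intro add_mono mult_mono) auto
  finally show ?thesis by (simp add: power2_eq_square)
qed

lemma aug_lagrangian_drift:
  assumes "norm C \<le> B" "norm D \<le> B" "norm u \<le> B" "norm v \<le> B" "norm w \<le> B"
  shows "aug_lagrangian C u v w \<le> aug_lagrangian D u v w + drift * norm (C - D)"
proof -
  let ?c = "C *v u - v" and ?d = "D *v u - v"
  have diff: "?c - ?d = (C - D) *v u"
    by (simp add: matrix_vector_mult_diff_rdistrib)
  have ncd: "norm (?c - ?d) \<le> norm (C - D) * B"
    unfolding diff using assms norm_matrix_vector_mult_le[of "C - D" u]
    by (meson mult_left_mono norm_ge_zero order_trans)
  have "- (w \<bullet> ?c) + w \<bullet> ?d \<le> norm w * norm (?c - ?d)"
    using Cauchy_Schwarz_ineq2[of w "?c - ?d"] unfolding inner_diff_right[of w ?c ?d] by linarith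
  also have "\<dots> \<le> B * (norm (C - D) * B)"
    using ncd assms B_nonneg by (intro mult_mono) auto
  finally have 1: "- (w \<bullet> ?c) + w \<bullet> ?d \<le> B * (norm (C - D) * B)" .
  have "(norm ?c)\<^sup>2 - (norm ?d)\<^sup>2 = (norm ?c - norm ?d) * (norm ?c + norm ?d)"
    by (simp add: power2_eq_square algebra_simps)
  also have "\<dots> \<le> (norm (C - D) * B) * ((B\<^sup>2 + B) + (B\<^sup>2 + B))"
    using ncd norm_triangle_ineq2[of ?c ?d] assms B_nonneg
    by (intro mult_mono add_mono norm_residual_le) auto
  finally have 2: "b / 2 * ((norm ?c)\<^sup>2 - (norm ?d)\<^sup>2)
      \<le> b / 2 * ((norm (C - D) * B) * ((B\<^sup>2 + B) + (B\<^sup>2 + B)))"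
    using b by (intro mult_left_mono) auto
  have "B * (norm (C - D) * B) + b / 2 * ((norm (C - D) * B) * ((B\<^sup>2 + B) + (B\<^sup>2 + B)))
      = drift * norm (C - D)"
    by (simp add: drift_def power2_eq_square algebra_simps)
  with 1 2 show ?thesis
    unfolding aug_lagrangian_def by (simp add: algebra_simps)
qed

lemma aug_lagrangian_bounded_below: "\<exists>m. \<forall>t>0. m \<le> aug_lagrangian (A t) (x t) (y t) (z t)"
proof -
  have "continuous_on (cball 0 B) h"
    using h_grad by (auto simp: gderiv_def intro!: continuous_at_imp_continuous_on has_derivative_continuous)
  then obtain u where u: "\<And>v. norm v \<le> B \<Longrightarrow> h u \<le> h v"
    using continuous_attains_inf[of "cball 0 B" h] B_nonneg
    by (metis cball_eq_empty compact_cball linorder_not_less mem_cball_0)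
  obtain m where m: "\<And>v. ereal (m - (norm v)\<^sup>2 / 2) \<le> P v"
    by (rule prox_tractable_lower_bound[OF P_proper P_prox]) blast
  have "h u + (m - B\<^sup>2 / 2) - B * (B\<^sup>2 + B) \<le> aug_lagrangian (A t) (x t) (y t) (z t)" if t: "0 < t" for t
  proof -
    have "m - (norm (y t))\<^sup>2 / 2 \<le> real_of_ereal (P (y t))"
      using m[of "y t"] P_y_finite[OF t] by (cases "P (y t)") auto
    moreover have "(norm (y t))\<^sup>2 \<le> B\<^sup>2"
      using bounds(2)[OF t] by (intro power_mono) auto
    moreover have "h u \<le> h (x t)"
      using u bounds(1)[OF t] by auto
    moreover have "z t \<bullet> (A t *v x t - y t) \<le> B * (B\<^sup>2 + B)"
    proof -
      have "z t \<bullet> (A t *v x t - y t) \<le> norm (z t) * norm (A t *v x t - y t)"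
        by (rule norm_cauchy_schwarz)
      also have "\<dots> \<le> B * (B\<^sup>2 + B)"
        using bounds t B_nonneg by (intro mult_mono norm_residual_le) auto
      finally show ?thesis .
    qed
    moreover have "0 \<le> b / 2 * (norm (A t *v x t - y t))\<^sup>2"
      using b by simp
    ultimately show ?thesis
      unfolding aug_lagrangian_def by linarith
  qed
  then show ?thesis by blast
qed

text \<open>Some of \<open>\<sigma>\<close> has to be given up to pass from \<open>E\<close> to \<open>A t\<close>. The factor \<open>3 / 4\<close> cancels the
  factor \<open>3\<close> of the inequality \<open>(a + c + e)\<^sup>2 \<le> 3 (a\<^sup>2 + c\<^sup>2 + e\<^sup>2)\<close> down to \<open>4\<close>, and
  \<open>4 / (b \<sigma>)\<close> is half of the constant in the oracle's requirement.\<close>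

lemma eventually_transpose_lower_bound:
  "\<forall>\<^sub>F t in sequentially. \<forall>v. 3 / 4 * \<sigma> * (norm v)\<^sup>2 \<le> (norm (transpose (A t) *v v))\<^sup>2"
proof -
  define \<eta> where "\<eta> = sqrt \<sigma> - sqrt (3 / 4 * \<sigma>)"
  have \<eta>: "0 < \<eta>"
    unfolding \<eta>_def using \<sigma>_pos by simp
  have "(\<lambda>t. norm (A t - E)) \<longlonglongrightarrow> 0"
    using A_lim by (simp add: LIM_zero_iff tendsto_norm_zero)
  then have "\<forall>\<^sub>F t in sequentially. norm (A t - E) < \<eta>"
    using \<eta> by (rule order_tendstoD)
  then show ?thesis
  proof (eventually_elim, intro allI)
    fix t v assume t: "norm (A t - E) < \<eta>"
    have "transpose E *v v - transpose (A t) *v v = transpose (E - A t) *v v"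
      by (simp only: transpose_diff matrix_vector_mult_diff_rdistrib)
    then have "norm (transpose E *v v - transpose (A t) *v v) \<le> norm (A t - E) * norm v"
      using norm_matrix_vector_mult_le[of "transpose (E - A t)" v]
      by (simp only: norm_transpose norm_minus_commute)
    also have "\<dots> \<le> \<eta> * norm v"
      using t by (intro mult_right_mono) auto
    finally have near: "norm (transpose E *v v - transpose (A t) *v v) \<le> \<eta> * norm v" .
    have "sqrt \<sigma> * norm v \<le> norm (transpose E *v v)"
      using real_sqrt_le_mono[OF \<sigma>_le[of v]] by (simp add: real_sqrt_mult)
    then have "sqrt (3 / 4 * \<sigma>) * norm v \<le> norm (transpose (A t) *v v)"
      using near norm_triangle_ineq2[of "transpose E *v v" "transpose (A t) *v v"]
      unfolding \<eta>_def left_diff_distrib by linarith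
    from power_mono[OF this, of 2] show "3 / 4 * \<sigma> * (norm v)\<^sup>2 \<le> (norm (transpose (A t) *v v))\<^sup>2"
      using \<sigma>_pos by (simp add: power_mult_distrib)
  qed
qed

text \<open>The difference of two consecutive stationarity conditions expresses \<open>A\<^sup>T (z'' - z')\<close> by a
  gradient step of \<open>h + \<phi>\<close>, the previous gradient step of \<open>\<phi>\<close>, and the change of the matrix.\<close>

lemma dual_step_bound:
  assumes t: "K < t"
    and lower: "\<And>v. 3 / 4 * \<sigma> * (norm v)\<^sup>2 \<le> (norm (transpose (A (Suc (Suc t))) *v v))\<^sup>2"
  shows "(norm (z (Suc (Suc t)) - z (Suc t)))\<^sup>2
    \<le> 4 / \<sigma> * (L1\<^sup>2 * (norm (x (Suc (Suc t)) - x (Suc t)))\<^sup>2 + L2\<^sup>2 * (norm (x (Suc t) - x t))\<^sup>2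
                 + B\<^sup>2 * (norm (A (Suc (Suc t)) - A (Suc t)))\<^sup>2)"
proof -
  let ?A' = "A (Suc (Suc t))" and ?A = "A (Suc t)"
  let ?x'' = "x (Suc (Suc t))" and ?x' = "x (Suc t)" and ?z' = "z (Suc t)"
  let ?dz = "z (Suc (Suc t)) - ?z'"
  let ?a = "L1 * norm (?x'' - ?x')" and ?c = "L2 * norm (?x' - x t)" and ?e = "B * norm (?A' - ?A)"
  have "transpose ?A' *v ?dz
      = ((gh ?x'' + gp ?x'') - (gh ?x' + gp ?x')) - (gp ?x' - gp (x t)) - transpose (?A' - ?A) *v ?z'"
    using dual_stationarity[OF t] dual_stationarity[of "Suc t"] t
    by (simp add: matrix_vector_mult_diff_distrib matrix_vector_mult_diff_rdistrib transpose_diff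
        del: transpose_matrix_vector)
  also have "norm \<dots> \<le> norm ((gh ?x'' + gp ?x'') - (gh ?x' + gp ?x')) + norm (gp ?x' - gp (x t))
      + norm (transpose (?A' - ?A) *v ?z')"
    by (meson add_mono norm_triangle_ineq4 order_refl order_trans)
  also have "\<dots> \<le> ?a + ?c + ?e"
  proof (intro add_mono lip1 lip2)
    have "norm (transpose (?A' - ?A) *v ?z') \<le> norm (?A' - ?A) * norm ?z'"
      using norm_matrix_vector_mult_le[of "transpose (?A' - ?A)" ?z'] by (simp only: norm_transpose)
    also have "\<dots> \<le> norm (?A' - ?A) * B"
      by (intro mult_left_mono bounds) auto
    finally show "norm (transpose (?A' - ?A) *v ?z') \<le> ?e"
      by (simp only: mult.commute)
  qed
  finally have "(norm (transpose ?A' *v ?dz))\<^sup>2 \<le> (?a + ?c + ?e)\<^sup>2"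
    by (intro power_mono) auto
  also have "\<dots> \<le> 3 * (?a\<^sup>2 + ?c\<^sup>2 + ?e\<^sup>2)"
    using zero_le_power2[of "?a - ?c"] zero_le_power2[of "?a - ?e"] zero_le_power2[of "?c - ?e"]
    by (simp add: power2_eq_square algebra_simps)
  finally have "3 / 4 * \<sigma> * (norm ?dz)\<^sup>2 \<le> 3 * (?a\<^sup>2 + ?c\<^sup>2 + ?e\<^sup>2)"
    using lower[of ?dz] by linarith
  then have "(norm ?dz)\<^sup>2 \<le> 4 / \<sigma> * (?a\<^sup>2 + ?c\<^sup>2 + ?e\<^sup>2)"
    using \<sigma>_pos by (simp add: field_simps)
  then show ?thesis
    by (simp add: power_mult_distrib)
qed

text \<open>The ascent of the multiplier step involves the current and the previous primal step. Adding
  \<open>c2\<close> times the squared last step to the augmented Lagrangian moves the previous step to the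
  left-hand side, and what remains in front of the current step is
  \<open>\<rho> / 2 - c1 - c2\<close>, which the oracle's requirement makes positive.\<close>

lemma lyapunov_descent:
  assumes t: "K < t"
    and lower: "\<And>v. 3 / 4 * \<sigma> * (norm v)\<^sup>2 \<le> (norm (transpose (A (Suc (Suc t))) *v v))\<^sup>2"
  defines "d \<equiv> \<lambda>s. (norm (x (Suc s) - x s))\<^sup>2"
    and "c1 \<equiv> 4 * L1\<^sup>2 / (\<sigma> * b)" and "c2 \<equiv> 4 * L2\<^sup>2 / (\<sigma> * b)"
  shows "aug_lagrangian (A (Suc (Suc t))) (x (Suc (Suc t))) (y (Suc (Suc t))) (z (Suc (Suc t))) + c2 * d (Suc t)
    \<le> aug_lagrangian (A (Suc t)) (x (Suc t)) (y (Suc t)) (z (Suc t)) + c2 * d t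
       - (\<rho> / 2 - c1 - c2) * d (Suc t)
       + (drift + 8 * B ^ 3 / (\<sigma> * b)) * norm (A (Suc (Suc t)) - A (Suc t))"
proof -
  let ?T = "Suc t"
  let ?\<delta> = "norm (A (Suc ?T) - A ?T)"
  have T: "K < ?T" using t by simp
  have "?\<delta> \<le> B + B"
    using norm_triangle_ineq4[of "A (Suc ?T)" "A ?T"] bounds(4)[of "Suc ?T"] bounds(4)[of ?T]
    by linarith
  then have "B\<^sup>2 * ?\<delta>\<^sup>2 \<le> B\<^sup>2 * ((B + B) * ?\<delta>)"
    unfolding power2_eq_square[of ?\<delta>] by (intro mult_left_mono mult_right_mono) auto
  then have "B\<^sup>2 * ?\<delta>\<^sup>2 \<le> 2 * B ^ 3 * ?\<delta>"
    by (simp add: power2_eq_square power3_eq_cube algebra_simps)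
  then have "(norm (z (Suc ?T) - z ?T))\<^sup>2
      \<le> 4 / \<sigma> * (L1\<^sup>2 * d ?T + L2\<^sup>2 * d t + 2 * B ^ 3 * ?\<delta>)"
    using \<sigma>_pos unfolding d_def
    by (intro order_trans[OF dual_step_bound[OF t lower]] mult_left_mono add_mono) auto
  then have "(norm (z (Suc ?T) - z ?T))\<^sup>2 / b
      \<le> 4 / \<sigma> * (L1\<^sup>2 * d ?T + L2\<^sup>2 * d t + 2 * B ^ 3 * ?\<delta>) / b"
    using b by (intro divide_right_mono) auto
  also have "\<dots> = c1 * d ?T + c2 * d t + 8 * B ^ 3 / (\<sigma> * b) * ?\<delta>"
    using b \<sigma>_pos by (simp add: c1_def c2_def field_simps)
  finally have dual: "(norm (z (Suc ?T) - z ?T))\<^sup>2 / b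
      \<le> c1 * d ?T + c2 * d t + 8 * B ^ 3 / (\<sigma> * b) * ?\<delta>" .
  have "aug_lagrangian (A (Suc ?T)) (x ?T) (y ?T) (z ?T)
      \<le> aug_lagrangian (A ?T) (x ?T) (y ?T) (z ?T) + drift * ?\<delta>"
    by (intro aug_lagrangian_drift bounds) auto
  with y_step_descent[OF T] x_step_descent[OF T] z_step_ascent[OF T] dual show ?thesis
    unfolding d_def by (simp add: algebra_simps)
qed

text \<open>The errors in the descent inequality are multiples of \<open>\<parallel>A\<^sub>t\<^sub>+\<^sub>1 - A\<^sub>t\<parallel>\<close> and hence summable, so the
  squared primal steps are summable too; the dual steps follow them to \<open>0\<close>.\<close>

lemma steps_vanish:
  shows "(\<lambda>t. x (Suc t) - x t) \<longlonglongrightarrow> 0" and "(\<lambda>t. z (Suc t) - z t) \<longlonglongrightarrow> 0"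
proof -
  define d where "d t = (norm (x (Suc t) - x t))\<^sup>2" for t
  define c1 where "c1 = 4 * L1\<^sup>2 / (\<sigma> * b)"
  define c2 where "c2 = 4 * L2\<^sup>2 / (\<sigma> * b)"
  define q where "q = \<rho> / 2 - c1 - c2"
  define C where "C = drift + 8 * B ^ 3 / (\<sigma> * b)"
  define L where "L t = aug_lagrangian (A t) (x t) (y t) (z t)" for t
  have q: "0 < q"
  proof -
    define G where "G = 8 / (b * \<sigma>) * (L1\<^sup>2 + L2\<^sup>2)"
    have "c1 + c2 = G / 2"
      using b \<sigma>_pos by (simp add: c1_def c2_def G_def field_simps)
    moreover have "G < \<rho>"
      using gap by (simp only: G_def)
    ultimately show ?thesis
      unfolding q_def by linarith
  qed
  have c2: "0 \<le> c2" and C: "0 \<le> C"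
    using b \<sigma>_pos B_nonneg drift_nonneg by (simp_all add: c2_def C_def)
  obtain N0 where N0: "\<And>t v. N0 \<le> t \<Longrightarrow> 3 / 4 * \<sigma> * (norm v)\<^sup>2 \<le> (norm (transpose (A t) *v v))\<^sup>2"
    using eventually_transpose_lower_bound unfolding eventually_sequentially by blast
  define N where "N = max N0 (Suc K)"
  have N: "K < t" "N0 \<le> Suc (Suc t)" if "N \<le> t" for t
    using that unfolding N_def by auto
  obtain m where m: "\<And>t. 0 < t \<Longrightarrow> m \<le> L t"
    using aug_lagrangian_bounded_below unfolding L_def by blast
  have "summable (\<lambda>n. q * d (Suc (n + N)))"
  proof (rule summable_of_almost_descent)
    let ?u = "\<lambda>n. L (Suc (n + N)) + c2 * d (n + N)"
    let ?e = "\<lambda>n. C * norm (A (Suc (Suc (n + N))) - A (Suc (n + N)))"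
    show "?u (Suc n) \<le> ?u n - q * d (Suc (n + N)) + ?e n" for n
      using lyapunov_descent[OF N(1) N0[OF N(2)], of "n + N"]
      by (simp add: L_def d_def c1_def c2_def q_def C_def)
    show "0 \<le> q * d (Suc (n + N))" for n
      using q by (simp add: d_def)
    show "m \<le> ?u n" for n
      using m[of "Suc (n + N)"] c2 by (simp add: d_def add_increasing2)
    show "0 \<le> ?e n" for n
      using C by simp
    have "summable (\<lambda>n. norm (A (Suc (n + Suc N)) - A (n + Suc N)))"
      using A_sum by (rule summable_ignore_initial_segment)
    then show "summable ?e"
      by (intro summable_mult) simp
  qed
  then have "(\<lambda>n. q * d (Suc (n + N))) \<longlonglongrightarrow> 0"
    by (rule summable_LIMSEQ_zero)
  then have "(\<lambda>n. d (n + Suc N)) \<longlonglongrightarrow> 0"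
    using q tendsto_mult_left[of "\<lambda>n. q * d (Suc (n + N))" 0 sequentially "1 / q"] by simp
  then have d: "d \<longlonglongrightarrow> 0"
    by (rule LIMSEQ_offset)
  from tendsto_real_sqrt[OF d] show "(\<lambda>t. x (Suc t) - x t) \<longlonglongrightarrow> 0"
    by (simp add: d_def tendsto_norm_zero_iff)
  have "(\<lambda>t. (norm (z (Suc (Suc t)) - z (Suc t)))\<^sup>2) \<longlonglongrightarrow> 0"
  proof (rule Lim_null_comparison)
    let ?g = "\<lambda>t. 4 / \<sigma> * (L1\<^sup>2 * d (Suc t) + L2\<^sup>2 * d t + B\<^sup>2 * (norm (A (Suc (Suc t)) - A (Suc t)))\<^sup>2)"
    show "\<forall>\<^sub>F t in sequentially. norm ((norm (z (Suc (Suc t)) - z (Suc t)))\<^sup>2) \<le> ?g t"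
      using eventually_ge_at_top[of N]
    proof eventually_elim
      case (elim t)
      show ?case
        using dual_step_bound[OF N(1) N0[OF N(2)], of t] elim by (simp add: d_def)
    qed
    have "(\<lambda>t. norm (A (Suc (Suc t)) - A (Suc t))) \<longlonglongrightarrow> 0"
      using LIMSEQ_Suc[OF summable_LIMSEQ_zero[OF A_sum]] .
    then have "?g \<longlonglongrightarrow> 4 / \<sigma> * (L1\<^sup>2 * 0 + L2\<^sup>2 * 0 + B\<^sup>2 * 0\<^sup>2)"
      by (intro tendsto_intros LIMSEQ_Suc[OF d] d)
    then show "?g \<longlonglongrightarrow> 0"
      by simp
  qed
  from tendsto_real_sqrt[OF this] have "(\<lambda>t. z (Suc (Suc t)) - z (Suc t)) \<longlonglongrightarrow> 0"
    by (simp add: tendsto_norm_zero_iff)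
  then show "(\<lambda>t. z (Suc t) - z t) \<longlonglongrightarrow> 0"
    by (rule LIMSEQ_imp_Suc)
qed

text \<open>Along the subsequence the three updates pass to the limit: the multiplier update becomes
  \<open>E x\<^sup>* = y\<^sup>*\<close>, stationarity becomes \<open>\<nabla>h(x\<^sup>*) = E\<^sup>T z\<^sup>*\<close>, and minimality of the \<open>y\<close>-step becomes
  \<open>- z\<^sup>* \<in> \<partial>P(y\<^sup>*)\<close>. As \<open>E\<close> is invertible, \<open>E\<^sup>-\<^sup>1 y\<^sub>k\<close> converges to \<open>x\<^sup>*\<close> and carries the Frechet subgradients
  of the composite function.\<close>

lemma cluster_point_critical:
  assumes "cluster_point (\<lambda>t. (x t, y t, z t)) (xs, ys, zs)"
  shows "0 \<in> limiting_subdifferential (\<lambda>u. ereal (h u) + P (E *v u)) xs"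
proof -
  obtain r where r: "strict_mono r" and lim: "((\<lambda>t. (x t, y t, z t)) \<circ> r) \<longlonglongrightarrow> (xs, ys, zs)"
    using assms unfolding cluster_point_def by blast
  \<comment> \<open>The subsequence is shifted past the stabilisation time \<open>K\<close>, and \<open>t k\<close> is the iteration that
    produces its \<open>k\<close>-th member.\<close>
  define t where "t k = r (k + (K + 2)) - 1" for k
  have ge: "k + (K + 2) \<le> r (k + (K + 2))" for k
    using strict_mono_imp_increasing[OF r] .
  have Suc_t: "Suc (t k) = r (k + (K + 2))" and t_gt: "K < t k" and t_ge: "k \<le> t k" for k
    using ge[of k] by (auto simp: t_def)
  have t_lim: "filterlim t at_top sequentially"
    using t_ge by (intro filterlim_at_top_mono[OF filterlim_ident]) auto
  have along: "(\<lambda>k. f (t k)) \<longlonglongrightarrow> l" if "f \<longlonglongrightarrow> l" for f :: "nat \<Rightarrow> 'b::topological_space" and l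
    using filterlim_compose[OF that t_lim] .
  have "(\<lambda>k. (x (Suc (t k)), y (Suc (t k)), z (Suc (t k)))) \<longlonglongrightarrow> (xs, ys, zs)"
    using LIMSEQ_ignore_initial_segment[OF lim, of "K + 2"] unfolding Suc_t by (simp add: o_def)
  from tendsto_fst[OF this] tendsto_fst[OF tendsto_snd[OF this]] tendsto_snd[OF tendsto_snd[OF this]]
  have x': "(\<lambda>k. x (Suc (t k))) \<longlonglongrightarrow> xs" and y': "(\<lambda>k. y (Suc (t k))) \<longlonglongrightarrow> ys"
    and z': "(\<lambda>k. z (Suc (t k))) \<longlonglongrightarrow> zs"
    by simp_all
  have xt: "(\<lambda>k. x (t k)) \<longlonglongrightarrow> xs"
    using tendsto_diff[OF x' along[OF steps_vanish(1)]] by simp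
  have zt: "(\<lambda>k. z (t k)) \<longlonglongrightarrow> zs"
    using tendsto_diff[OF z' along[OF steps_vanish(2)]] by simp
  have A': "(\<lambda>k. A (Suc (t k))) \<longlonglongrightarrow> E"
    using along[OF LIMSEQ_Suc[OF A_lim]] .
  have Ax: "(\<lambda>k. A (Suc (t k)) *v x (t k)) \<longlonglongrightarrow> E *v xs"
    by (rule tendsto_matrix_vector_mult[OF A' xt])

  have ys: "E *v xs = ys"
  proof -
    have "(\<lambda>k. (- 1 / b) *\<^sub>R (z (Suc (t k)) - z (t k))) \<longlonglongrightarrow> (- 1 / b) *\<^sub>R 0"
      by (intro tendsto_intros along[OF steps_vanish(2)])
    moreover have "(- 1 / b) *\<^sub>R (z (Suc (t k)) - z (t k)) = A (Suc (t k)) *v x (Suc (t k)) - y (Suc (t k))" for k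
      using b by (simp add: z_update[OF t_gt])
    ultimately have "(\<lambda>k. A (Suc (t k)) *v x (Suc (t k)) - y (Suc (t k))) \<longlonglongrightarrow> 0"
      by simp
    moreover have "(\<lambda>k. A (Suc (t k)) *v x (Suc (t k)) - y (Suc (t k))) \<longlonglongrightarrow> E *v xs - ys"
      by (intro tendsto_diff tendsto_matrix_vector_mult A' x' y')
    ultimately show ?thesis
      using LIMSEQ_unique by fastforce
  qed

  have stationary: "gh xs = transpose E *v zs"
  proof -
    have "(\<lambda>s. gp (x (Suc s)) - gp (x s)) \<longlonglongrightarrow> 0"
    proof (rule Lim_null_comparison)
      show "\<forall>\<^sub>F s in sequentially. norm (gp (x (Suc s)) - gp (x s)) \<le> L2 * norm (x (Suc s) - x s)"
        using lip2 by simp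
      show "(\<lambda>s. L2 * norm (x (Suc s) - x s)) \<longlonglongrightarrow> 0"
        using tendsto_mult_left[OF tendsto_norm_zero[OF steps_vanish(1)], of L2] by simp
    qed
    from along[OF this] have "(\<lambda>k. gh (x (Suc (t k))) + (gp (x (Suc (t k))) - gp (x (t k)))) \<longlonglongrightarrow> gh xs + 0"
      using gh_cont x' by (intro tendsto_add continuous_on_tendsto_compose[OF gh_cont x']) auto
    then have "(\<lambda>k. transpose (A (Suc (t k))) *v z (Suc (t k))) \<longlonglongrightarrow> gh xs"
      unfolding dual_stationarity[OF t_gt] by (simp add: add_diff_eq)
    moreover have "(\<lambda>k. transpose (A (Suc (t k))) *v z (Suc (t k))) \<longlonglongrightarrow> transpose E *v zs"
      by (intro tendsto_matrix_vector_mult tendsto_transpose A' z')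
    ultimately show ?thesis
      by (rule LIMSEQ_unique)
  qed

  define c where "c k u = z (t k) \<bullet> u + b / 2 * (norm (A (Suc (t k)) *v x (t k) - u))\<^sup>2" for k u
  define cs where "cs u = zs \<bullet> u + b / 2 * (norm (E *v xs - u))\<^sup>2" for u
  define yk where "yk k = y (Suc (t k))" for k
  have yk: "yk \<longlonglongrightarrow> ys"
    using y' by (simp add: yk_def[abs_def])
  have c_lim: "(\<lambda>k. c k (u k)) \<longlonglongrightarrow> cs v" if "u \<longlonglongrightarrow> v" for u v
    unfolding c_def cs_def by (intro tendsto_intros zt Ax that)
  have fin: "\<bar>P (yk k)\<bar> \<noteq> \<infinity>" for k
    unfolding yk_def by (rule P_y_finite) simp
  have opt: "P (yk k) + ereal (c k (yk k)) \<le> P u + ereal (c k u)" for k u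
    using argmin_perturbed_finite(2)[OF P_proper y_argmin, of "t k" u]
    by (simp add: yk_def c_def \<beta>_tail[OF t_gt])
  have lower: "P ys \<le> liminf (\<lambda>k. P (yk k))"
    by (rule lower_semicontinuous_liminf[OF P_lsc yk])
  \<comment> \<open>The choice \<open>a \<in> dom P\<close> shows that \<open>P ys\<close> is finite; then \<open>a = ys\<close> gives convergence of
    the values.\<close>
  have upper: "limsup (\<lambda>k. P (yk k)) \<le> ereal (s + cs a - cs ys)" if "P a = ereal s" for a s
  proof -
    have "(\<lambda>k. ereal (s + c k a - c k (yk k))) \<longlonglongrightarrow> ereal (s + cs a - cs ys)"
      by (intro tendsto_intros c_lim yk tendsto_const)
    then have "limsup (\<lambda>k. ereal (s + c k a - c k (yk k))) = ereal (s + cs a - cs ys)"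
      by (intro lim_imp_Limsup) auto
    moreover have "P (yk k) \<le> ereal (s + c k a - c k (yk k))" for k
      using opt[of k a] fin[of k] that by (cases "P (yk k)") auto
    ultimately show ?thesis
      by (metis (no_types, lifting) Limsup_mono always_eventually)
  qed
  have liminf_le: "liminf (\<lambda>k. P (yk k)) \<le> limsup (\<lambda>k. P (yk k))"
    by (rule Liminf_le_Limsup) simp
  have neg: "P v \<noteq> -\<infinity>" for v
    using P_proper by (simp add: proper_def)
  obtain a s where "P a = ereal s"
    using P_proper unfolding proper_def by (metis ereal_cases)
  from upper[OF this] have "P ys < \<infinity>"
    using lower liminf_le by (meson le_less_trans less_ereal.simps(4) order_trans)
  then obtain p where p: "P ys = ereal p"
    using neg[of ys] by (cases "P ys") auto
  have P_lim: "(\<lambda>k. P (yk k)) \<longlonglongrightarrow> P ys"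
    using upper[OF p] lower liminf_le
    by (subst tendsto_iff_Liminf_eq_Limsup) (auto simp: p)

  obtain E' where E': "E ** E' = mat 1" "E' ** E = mat 1"
    using full_rank by (metis full_rank_injective matrix_left_invertible_injective matrix_left_right_inverse)
  define xk where "xk k = E' *v yk k" for k
  have E_xk: "E *v xk k = yk k" for k
    by (simp add: xk_def matrix_vector_mul_assoc E')
  have "xk \<longlonglongrightarrow> E' *v ys"
    unfolding xk_def by (intro tendsto_matrix_vector_mult tendsto_const yk)
  also have "E' *v ys = xs"
    by (simp add: ys[symmetric] matrix_vector_mul_assoc E')
  finally have xk: "xk \<longlonglongrightarrow> xs" .
  define w where "w k = b *\<^sub>R (A (Suc (t k)) *v x (t k) - yk k) - z (t k)" for k
  have "w \<longlonglongrightarrow> b *\<^sub>R (E *v xs - ys) - zs"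
    unfolding w_def by (intro tendsto_intros Ax yk zt)
  then have w: "w \<longlonglongrightarrow> - zs"
    by (simp add: ys)
  define v where "v k = gh (xk k) + transpose E *v w k" for k
  have "v \<longlonglongrightarrow> gh xs + transpose E *v (- zs)"
    unfolding v_def
    by (intro tendsto_add tendsto_matrix_vector_mult tendsto_const w
        continuous_on_tendsto_compose[OF gh_cont xk]) auto
  also have "gh xs + transpose E *v (- zs) = 0"
    using matrix_vector_mult_diff_distrib[of "transpose E" 0 zs]
    by (simp add: stationary del: transpose_matrix_vector)
  finally have v: "v \<longlonglongrightarrow> 0" .

  \<comment> \<open>The penalty of the \<open>y\<close>-step is an exact quadratic, so minimality is the same as a
    quadratic minorant.\<close>
  have minorant: "P (yk k) + ereal (w k \<bullet> (u - yk k) - b / 2 * (norm (u - yk k))\<^sup>2) \<le> P u" for k u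
  proof -
    let ?a = "A (Suc (t k)) *v x (t k)"
    have "?a - u = (?a - yk k) - 1 *\<^sub>R (u - yk k)"
      by simp
    then have sq: "(norm (?a - u))\<^sup>2
        = (norm (?a - yk k))\<^sup>2 - 2 * ((?a - yk k) \<bullet> (u - yk k)) + (norm (u - yk k))\<^sup>2"
      by (metis norm_diff_scaleR_square mult.right_neutral mult_1 one_power2)
    have "c k u - c k (yk k) = z (t k) \<bullet> (u - yk k) + b / 2 * ((norm (?a - u))\<^sup>2 - (norm (?a - yk k))\<^sup>2)"
      by (simp add: c_def inner_diff_right right_diff_distrib)
    also have "\<dots> = z (t k) \<bullet> (u - yk k) - b * ((?a - yk k) \<bullet> (u - yk k)) + b / 2 * (norm (u - yk k))\<^sup>2"
      unfolding sq by (simp add: field_simps)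
    also have "\<dots> = b / 2 * (norm (u - yk k))\<^sup>2 - w k \<bullet> (u - yk k)"
      unfolding w_def inner_diff_left[of "b *\<^sub>R _"] by simp
    finally have "c k u - c k (yk k) = b / 2 * (norm (u - yk k))\<^sup>2 - w k \<bullet> (u - yk k)" .
    then show ?thesis
      using opt[of k u] fin[of k] by (cases "P (yk k)"; cases "P u") auto
  qed

  let ?F = "\<lambda>u. ereal (h u) + P (E *v u)"
  have h_cont: "isCont h u" for u
    using h_grad[of u] by (auto simp: gderiv_def intro: has_derivative_continuous)
  have F_lim: "(\<lambda>k. ?F (xk k)) \<longlonglongrightarrow> ?F xs"
    unfolding E_xk ys using P_lim p
    by (intro tendsto_add_ereal tendsto_ereal isCont_tendsto_compose[OF h_cont xk]) auto
  have F_fin: "\<bar>?F xs\<bar> \<noteq> \<infinity>"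
    by (simp add: ys p)
  have F_fin_k: "\<bar>?F (xk k)\<bar> \<noteq> \<infinity>" for k
    using fin[of k] by (cases "P (yk k)") (auto simp: E_xk)
  have subgrad: "0 \<le> Liminf (at (xk k)) (\<lambda>u. (?F u - ?F (xk k) - ereal (v k \<bullet> (u - xk k)))
                                                 / ereal (norm (u - xk k)))" for k
    unfolding v_def
    by (rule frechet_subgradient_composite[where c = "b / 2"]) (use h_grad fin minorant in \<open>auto simp: E_xk\<close>)
  show ?thesis
    unfolding limiting_subdifferential_def
    by (intro CollectI conjI exI[of _ xk] exI[of _ v] allI F_lim F_fin F_fin_k subgrad xk v)
qed

end

section \<open>Cluster points are critical points almost surely\<close>

text \<open>An infinite empirical Lipschitz constant would make the oracle's lower bound on \<open>\<rho>\<close> infinite.\<close>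

lemma square_ereal_finite: "0 < c \<Longrightarrow> ereal c * (a\<^sup>2 + b\<^sup>2) < ereal r \<Longrightarrow> a \<noteq> \<infinity> \<and> b \<noteq> (\<infinity>::ereal)"
  by (cases a; cases b) (auto simp: power2_eq_square)

text \<open>The whole argument on one sample path; randomness enters only through the two properties
  of the matrices \<open>A\<close>.\<close>

lemma meta_isad_cluster_point_critical:
  fixes h \<phi> :: "real^'n \<Rightarrow> real" and E :: "real^'n^'n"
  assumes h: "twice_continuously_differentiable h"
    and P: "proper P" "lower_semicontinuous P" "prox_tractable P"
    and \<phi>: "convex_on UNIV \<phi>" "twice_continuously_differentiable \<phi>"
    and rank: "rank E = CARD('n)"
    and A: "A \<longlonglongrightarrow> E" "summable (\<lambda>t. norm (A (Suc t) - A t))"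
    and run: "meta_isad h P \<phi> A x0 z0 \<beta>0 x y z \<beta>"
    and apo: "apo_requirements (lambda_min (transpose E ** E)) h \<phi> A x y z \<beta>"
    and bdd: "bounded ((\<lambda>t. (x t, y t, z t)) ` {0<..})"
    and cluster: "cluster_point (\<lambda>t. (x t, y t, z t)) (xs, ys, zs)"
  shows "0 \<in> limiting_subdifferential (\<lambda>u. ereal (h u) + P (E *v u)) xs"
proof -
  define \<sigma> where "\<sigma> = lambda_min (transpose E ** E)"
  have \<sigma>: "0 < \<sigma>"
    unfolding \<sigma>_def by (rule lambda_min_gram(1)[OF rank])
  obtain gh Hh where gh: "\<And>u. GDERIV h u :> gh u" "\<And>u. (gh has_derivative (\<lambda>v. Hh u *v v)) (at u)"
    using h unfolding twice_continuously_differentiable_def by blast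
  obtain gp where gp: "\<And>u. GDERIV \<phi> u :> gp u"
    using \<phi>(2) unfolding twice_continuously_differentiable_def by blast
  have gh_cont: "continuous_on UNIV gh"
    using gh(2) by (auto intro!: continuous_at_imp_continuous_on has_derivative_continuous)
  from apo obtain K \<rho> where \<beta>_pos: "\<And>t. 0 < \<beta> t" and K: "\<And>k. K < k \<Longrightarrow> \<beta> k = \<beta> K"
    and descent: "\<And>k. K < k \<Longrightarrow>
        x_objective h \<phi> A x y z \<beta> k (x (Suc k)) - x_objective h \<phi> A x y z \<beta> k (x k)
          \<le> - (\<rho> / 2) * (norm (x (Suc k) - x k))\<^sup>2"
    and gap: "\<And>k. K < k \<Longrightarrow> ereal \<rho> > ereal (8 / (\<beta> k * \<sigma>)) *
          ((empirical_lipschitz (\<lambda>u. grad h u + grad \<phi> u) x)\<^sup>2 + (empirical_lipschitz (grad \<phi>) x)\<^sup>2)"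
    unfolding apo_requirements_def \<sigma>_def[symmetric] by blast
  let ?b = "\<beta> K"
  have grad_h: "grad h = gh" and grad_\<phi>: "grad \<phi> = gp"
    using grad_eqI gh(1) gp by blast+
  have gap': "ereal (8 / (?b * \<sigma>)) * ((empirical_lipschitz (\<lambda>u. gh u + gp u) x)\<^sup>2
      + (empirical_lipschitz gp x)\<^sup>2) < ereal \<rho>"
    using gap[of "Suc K"] K[of "Suc K"] by (simp add: grad_h grad_\<phi>)
  have "0 < 8 / (?b * \<sigma>)"
    using \<beta>_pos[of K] \<sigma> by simp
  from square_ereal_finite[OF this gap']
  have finite: "empirical_lipschitz (\<lambda>u. gh u + gp u) x \<noteq> \<infinity>" "empirical_lipschitz gp x \<noteq> \<infinity>"
    by auto
  obtain L1 where L1: "empirical_lipschitz (\<lambda>u. gh u + gp u) x = ereal L1"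
      "\<And>t. norm ((gh (x (Suc t)) + gp (x (Suc t))) - (gh (x t) + gp (x t))) \<le> L1 * norm (x (Suc t) - x t)"
    by (rule empirical_lipschitz_bound[OF finite(1)]) blast
  obtain L2 where L2: "empirical_lipschitz gp x = ereal L2"
      "\<And>t. norm (gp (x (Suc t)) - gp (x t)) \<le> L2 * norm (x (Suc t) - x t)"
    by (rule empirical_lipschitz_bound[OF finite(2)]) blast
  obtain B1 where B1: "\<And>t. 0 < t \<Longrightarrow> norm (x t, y t, z t) \<le> B1"
    using bdd unfolding bounded_iff by auto
  obtain B2 where B2: "\<And>t. norm (A t) \<le> B2"
    using convergent_imp_bounded[OF A(1)] unfolding bounded_iff by auto
  have comps: "norm (x t) \<le> B1" "norm (y t) \<le> B1" "norm (z t) \<le> B1" if "0 < t" for t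
    using B1[OF that] norm_fst_le[of "x t" "(y t, z t)"] norm_snd_le[of "(y t, z t)" "x t"]
      norm_fst_le[of "y t" "z t"] norm_snd_le[of "z t" "y t"] by auto
  interpret isad_run h \<phi> gh gp P E A x y z x0 z0 \<beta> \<sigma> ?b \<beta>0 \<rho> L1 L2 "max B1 B2" K
  proof
    show "8 / (?b * \<sigma>) * (L1\<^sup>2 + L2\<^sup>2) < \<rho>"
      using gap' by (simp add: L1(1) L2(1))
    show "rank E = CARD('n)" "\<sigma> = lambda_min (transpose E ** E)"
      by (fact rank \<sigma>_def)+
    show "norm (x t) \<le> max B1 B2" "norm (y t) \<le> max B1 B2" "norm (z t) \<le> max B1 B2" if "0 < t" for t
      using comps[OF that] by simp_all
    show "norm (A t) \<le> max B1 B2" for t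
      using B2[of t] by simp
  qed (fact gh(1) gh_cont \<phi>(1) gp P A run \<beta>_pos K descent L1(2) L2(2))+
  show ?thesis
    by (rule cluster_point_critical[OF cluster])
qed

theorem theorem5:
  fixes h \<phi> :: "real^'n \<Rightarrow> real"
    and P :: "real^'n \<Rightarrow> ereal"
    and \<Omega> :: "'w measure"
    and \<pi> :: "(real^'n^'n) measure"
    and M :: "nat \<Rightarrow> 'w \<Rightarrow> real^'n^'n"
    and \<epsilon> \<beta>0 :: real
    and x0 z0 :: "real^'n"
    and x y z :: "nat \<Rightarrow> 'w \<Rightarrow> real^'n"
    and \<beta> :: "nat \<Rightarrow> 'w \<Rightarrow> real"
  defines "EM \<equiv> mean_matrix \<pi>"
    and "A \<equiv> \<lambda>\<omega>. sample_mean (\<lambda>i. M i \<omega>) (sample_size \<pi> \<epsilon>)"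
  assumes h: "twice_continuously_differentiable h"
    and P: "proper P" "lower_semicontinuous P" "prox_tractable P"
    and \<phi>: "convex_on UNIV \<phi>" "twice_continuously_differentiable \<phi>"
    and \<Omega>: "prob_space \<Omega>"
    and M_indep: "prob_space.indep_vars \<Omega> (\<lambda>_. borel) M {1..}"
    and M_distr: "\<And>i. i \<ge> 1 \<Longrightarrow> distr \<Omega> borel (M i) = \<pi>"
    and var: "finite_entrywise_variance \<pi>"
    and full_rank: "rank EM = CARD('n)"
    and \<epsilon>: "\<epsilon> > 0"
    and \<beta>0: "\<beta>0 > 0"
    and algorithm: "AE \<omega> in \<Omega>. meta_isad h P \<phi> (A \<omega>) x0 z0 \<beta>0
          (\<lambda>t. x t \<omega>) (\<lambda>t. y t \<omega>) (\<lambda>t. z t \<omega>) (\<lambda>t. \<beta> t \<omega>)"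
    and apo: "AE \<omega> in \<Omega>. apo_requirements (lambda_min (transpose EM ** EM)) h \<phi> (A \<omega>)
          (\<lambda>t. x t \<omega>) (\<lambda>t. y t \<omega>) (\<lambda>t. z t \<omega>) (\<lambda>t. \<beta> t \<omega>)"
    and bdd: "AE \<omega> in \<Omega>. bounded ((\<lambda>t. (x t \<omega>, y t \<omega>, z t \<omega>)) ` {0<..})"
  shows "AE \<omega> in \<Omega>. \<forall>xs ys zs.
           cluster_point (\<lambda>t. (x t \<omega>, y t \<omega>, z t \<omega>)) (xs, ys, zs) \<longrightarrow>
           0 \<in> limiting_subdifferential (\<lambda>u. ereal (h u) + P (EM *v u)) xs"
proof -
  have "AE \<omega> in \<Omega>. A \<omega> \<longlonglongrightarrow> EM \<and> summable (\<lambda>t. norm (A \<omega> (Suc t) - A \<omega> t))"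
    unfolding A_def EM_def
    by (rule sample_mean_convergence[OF \<Omega> M_indep M_distr var \<epsilon>])
  with algorithm apo bdd show ?thesis
  proof eventually_elim
    case (elim \<omega>)
    then show ?case
      using meta_isad_cluster_point_critical[OF h P \<phi> full_rank] by blast
  qed
qed

end
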